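(* Let $\Gamma$ be the graph whose components are $s$ cycles of lengths $\ell_1,\ell_2,\dots,\ell_s\ge 3$ and one path of length $m$ (i.e. with $m$ edges), and let $I=\{i\mid 1\le i\le s,\ \ell_i \text{ is even}\}$. Put \[m_0=2|I|\max\{\ell_i+3\mid i\in I\}-1,\qquad m_1=7^{\,s-|I|-1}\max\{2\ell_i+1\mid i\notin I\}.\] Then $\Gamma$ has a graceful labeling whenever $m\ge 6\max(1,m_0)+7\max(3,m_1)+9$.
   Context: The maximum of an empty set of integers is taken to be $0$. For a graph with $\epsilon$ edges, a graceful labeling is an injective assignment of integers from $\{0,1,\dots,\epsilon\}$ to the vertices such that the absolute differences of the labels of the endpoints of the edges are exactly $1,2,\dots,\epsilon$ (each once). Here $\Gamma$ has $\epsilon=\sum_i\ell_i+m$ edges and $\epsilon+1$ vertices. *)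

theory Defs
  imports Complex_Main
begin

definition simple_graph :: "'a set \<Rightarrow> 'a set set \<Rightarrow> bool" where
  "simple_graph V E \<longleftrightarrow> finite V \<and> (\<forall>e\<in>E. e \<subseteq> V \<and> card e = 2)"

definition connected_rel :: "'a set \<Rightarrow> 'a set set \<Rightarrow> ('a \<times> 'a) set" where
  "connected_rel V E = {(u, v). u \<in> V \<and> v \<in> V \<and> (u, v) \<in> {(x, y). {x, y} \<in> E}\<^sup>*}"

text \<open>The vertex sets of the connected components.\<close>

definition components :: "'a set \<Rightarrow> 'a set set \<Rightarrow> 'a set set" where
  "components V E = V // connected_rel V E"

definition induced_edges :: "'a set set \<Rightarrow> 'a set \<Rightarrow> 'a set set" where
  "induced_edges E W = {e \<in> E. e \<subseteq> W}"

definition is_cycle :: "'a set \<Rightarrow> 'a set set \<Rightarrow> nat \<Rightarrow> bool" where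
  "is_cycle V E n \<longleftrightarrow> n \<ge> 3 \<and>
     (\<exists>c. bij_betw c {..<n} V \<and> E = {{c j, c (Suc j mod n)} | j. j < n})"

text \<open>The length of a path is its number of edges, so it has \<open>n + 1\<close> vertices.\<close>

definition is_path :: "'a set \<Rightarrow> 'a set set \<Rightarrow> nat \<Rightarrow> bool" where
  "is_path V E n \<longleftrightarrow>
     (\<exists>p. bij_betw p {..n} V \<and> E = {{p j, p (Suc j)} | j. j < n})"

text \<open>Here \<open>C 0\<close> is the path component and \<open>C i\<close>, for \<open>1 \<le> i \<le> s\<close>, the \<open>i\<close>-th cycle.\<close>

definition cycles_and_path ::
  "'a set \<Rightarrow> 'a set set \<Rightarrow> nat \<Rightarrow> (nat \<Rightarrow> nat) \<Rightarrow> nat \<Rightarrow> bool" where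
  "cycles_and_path V E s l m \<longleftrightarrow> simple_graph V E \<and>
     (\<exists>C. bij_betw C {0..s} (components V E) \<and>
          is_path (C 0) (induced_edges E (C 0)) m \<and>
          (\<forall>i\<in>{1..s}. is_cycle (C i) (induced_edges E (C i)) (l i)))"

definition edge_diff :: "('a \<Rightarrow> int) \<Rightarrow> 'a set \<Rightarrow> int" where
  "edge_diff f e = (THE d. \<exists>u v. e = {u, v} \<and> d = \<bar>f u - f v\<bar>)"

lemma edge_diff_pair: "edge_diff f {u, v} = \<bar>f u - f v\<bar>"
  unfolding edge_diff_def by (rule the_equality) (auto simp: doubleton_eq_iff)

definition graceful_labeling :: "'a set \<Rightarrow> 'a set set \<Rightarrow> ('a \<Rightarrow> int) \<Rightarrow> bool" where
  "graceful_labeling V E f \<longleftrightarrow>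
     inj_on f V \<and> f ` V \<subseteq> {0..int (card E)} \<and>
     bij_betw (edge_diff f) E {1..int (card E)}"

definition max0 :: "nat set \<Rightarrow> nat" where
  "max0 A = (if A = {} then 0 else Max A)"

definition even_idx :: "nat \<Rightarrow> (nat \<Rightarrow> nat) \<Rightarrow> nat set" where
  "even_idx s l = {i \<in> {1..s}. even (l i)}"

definition m_zero :: "nat \<Rightarrow> (nat \<Rightarrow> nat) \<Rightarrow> real" where
  "m_zero s l = 2 * real (card (even_idx s l)) * real (max0 ((\<lambda>i. l i + 3) ` even_idx s l)) - 1"

text \<open>The exponent is the integer \<open>-1\<close> when all cycles are even; the maximum is then 0.\<close>

definition m_one :: "nat \<Rightarrow> (nat \<Rightarrow> nat) \<Rightarrow> real" where
  "m_one s l = 7 powi (int s - int (card (even_idx s l)) - 1)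
     * real (max0 ((\<lambda>i. 2 * l i + 1) ` ({1..s} - even_idx s l)))"

end

theory Submission
  imports Defs "HOL-Library.Multiset"
begin

text \<open>
  Split the labels \<open>0, \<dots>, N\<close> at a threshold into low labels \<open>x\<close> and high labels \<open>N - y\<close>; an edge from
  \<open>x\<close> to \<open>N - y\<close> has difference \<open>N - (x + y)\<close>. An \<open>\<alpha>\<close>-block labels some cycles and a path so that
  every edge crosses the threshold. Inserting \<open>D + 1\<close> labels at the threshold raises all its differences
  by \<open>D + 1\<close>, so a block can be wrapped around a graceful labelling with \<open>D\<close> edges; the edge that links
  the two paths supplies the missing difference \<open>D + 1\<close>. The ends of the two paths match when the inner
  path starts at label \<open>r\<close> and the ends of the block's path lie \<open>r\<close> places from the outside and \<open>r\<close>
  places from the threshold.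

  Even cycles live in \<open>\<alpha>\<close>-blocks, and a Euclidean recursion yields path blocks for nearly all sizes and
  all \<open>r\<close>. A cycle of odd length needs an edge between two low labels: it receives the difference
  \<open>D + 1\<close>, and everything else of a new layer around a labelling with \<open>D\<close> edges crosses the
  threshold. Up to lower order terms such a layer maps \<open>(D, r)\<close> to \<open>(5 D - 2 r, 2 D - r)\<close>, which grows
  more slowly than the powers of 7 in the hypothesis.
\<close>

section \<open>Labellings and blocks\<close>

definition diffs :: "int list \<Rightarrow> int set" where
  "diffs xs = {\<bar>xs ! j - xs ! Suc j\<bar> | j. Suc j < length xs}"

definition alternates :: "int \<Rightarrow> int list \<Rightarrow> bool" where
  "alternates p xs \<longleftrightarrow> successively (\<lambda>x y. (x < p) \<noteq> (y < p)) xs"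

text \<open>Opens a gap of \<open>b - a\<close> labels at the threshold \<open>p\<close>. If
  \<open>a \<le> b\<close>, a list that alternates across \<open>p\<close> has all its differences
  raised by this amount.\<close>

definition spread :: "int \<Rightarrow> int \<Rightarrow> int \<Rightarrow> int \<Rightarrow> int" where
  "spread a b p x = (if x < p then x + a else x + b)"

definition labels :: "int list \<Rightarrow> int list list \<Rightarrow> int set" where
  "labels P cs = set P \<union> \<Union> (set ` set cs)"

text \<open>A cycle is stored as the list of its vertices; the appended \<open>hd c\<close> supplies
  its closing edge.\<close>

definition differences :: "int list \<Rightarrow> int list list \<Rightarrow> int set" where
  "differences P cs = diffs P \<union> (\<Union>c\<in>set cs. diffs (c @ [hd c]))"

text \<open>
  Only the inclusions are required: there are exactly \<open>n\<close> vertices and \<open>n - 1\<close> edges, so they force all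
  labels and all differences to be distinct.
\<close>

definition labelled :: "nat multiset \<Rightarrow> int \<Rightarrow> int list \<Rightarrow> int list list \<Rightarrow> bool" where
  "labelled M n P cs \<longleftrightarrow> P \<noteq> [] \<and> mset (map length cs) = M \<and> [] \<notin> set cs \<and>
     int (length P) + int (sum_mset M) = n \<and> {0..<n} \<subseteq> labels P cs \<and> {1..<n} \<subseteq> differences P cs"

definition crossing :: "int \<Rightarrow> int list \<Rightarrow> int list list \<Rightarrow> bool" where
  "crossing p P cs \<longleftrightarrow> alternates p P \<and> (\<forall>c\<in>set cs. alternates p (c @ [hd c]))"

text \<open>
  The path is oriented so that it starts at the low label \<open>r\<close>; it ends at distance \<open>r\<close> from the
  threshold, on the high side for even \<open>n\<close> and on the low side for odd \<open>n\<close>.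
\<close>

definition alpha_block :: "nat multiset \<Rightarrow> int \<Rightarrow> int \<Rightarrow> bool" where
  "alpha_block M n r \<longleftrightarrow> 0 \<le> r \<and> r < (n + 1) div 2 \<and>
     (\<exists>P cs. labelled M n P cs \<and> crossing ((n + 1) div 2) P cs \<and> hd P = r \<and>
        last P = (if even n then n div 2 + r else (n + 1) div 2 - 1 - r))"

text \<open>Here \<open>n\<close> counts edges, whereas in \<open>alpha_block\<close> it counts
  vertices; thus the two parameters simply add when a block is wrapped around a labelling.\<close>

definition graceful_from :: "nat multiset \<Rightarrow> int \<Rightarrow> int \<Rightarrow> bool" where
  "graceful_from M n r \<longleftrightarrow> (\<exists>P cs. labelled M (n + 1) P cs \<and> hd P = r)"

section \<open>Shifts, reflections and reversals of labelled lists\<close>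

lemma diffs_Nil [simp]: "diffs [] = {}"
  and diffs_single [simp]: "diffs [x] = {}"
  by (auto simp: diffs_def)

lemma diffs_Cons [simp]: "diffs (x # y # zs) = insert \<bar>x - y\<bar> (diffs (y # zs))"
proof -
  have "{j. Suc j < length (x # y # zs)} = insert 0 (Suc ` {j. Suc j < length (y # zs)})"
    by (auto simp: image_iff less_Suc_eq_0_disj)
  moreover have "diffs xs = (\<lambda>j. \<bar>xs ! j - xs ! Suc j\<bar>) ` {j. Suc j < length xs}" for xs
    by (auto simp: diffs_def)
  ultimately show ?thesis
    by (simp add: image_image)
qed

lemma diffs_append:
  assumes "xs \<noteq> []" "ys \<noteq> []"
  shows "diffs (xs @ ys) = insert \<bar>last xs - hd ys\<bar> (diffs xs \<union> diffs ys)"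
  using assms
proof (induction xs)
  case (Cons x xs)
  then show ?case
    by (cases xs; cases ys) auto
qed simp

lemma diffs_rev [simp]: "diffs (rev xs) = diffs xs"
proof (induction xs)
  case IH: (Cons x xs)
  show ?case
  proof (cases xs)
    case (Cons y zs)
    then have "diffs (rev xs @ [x]) = insert \<bar>last (rev xs) - x\<bar> (diffs xs)"
      using IH.IH by (subst diffs_append) auto
    then show ?thesis
      using Cons by (simp add: abs_minus_commute)
  qed simp
qed simp

lemma diffs_translate [simp]: "diffs (map (\<lambda>x. x + c) xs) = diffs xs"
proof (induction xs)
  case (Cons x xs)
  then show ?case by (cases xs) auto
qed simp

lemma diffs_reflect [simp]: "diffs (map (\<lambda>x. c - x) xs) = diffs xs"
proof (induction xs)
  case (Cons x xs)
  then show ?case by (cases xs) (auto simp: abs_minus_commute)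
qed simp

lemma diffs_spread:
  assumes "alternates p xs" "a \<le> b"
  shows "diffs (map (spread a b p) xs) = (\<lambda>d. d + (b - a)) ` diffs xs"
  using assms
proof (induction xs)
  case (Cons x xs)
  show ?case
  proof (cases xs)
    case (Cons y zs)
    then have "alternates p xs" "(x < p) \<noteq> (y < p)"
      using Cons.prems by (auto simp: alternates_def)
    then show ?thesis
      using Cons.IH Cons.prems Cons by (auto simp: spread_def)
  qed simp
qed simp

lemma alternates_append_iff:
  "xs \<noteq> [] \<Longrightarrow> ys \<noteq> [] \<Longrightarrow>
    alternates p (xs @ ys) \<longleftrightarrow> alternates p xs \<and> alternates p ys \<and> (last xs < p) \<noteq> (hd ys < p)"
  by (auto simp: alternates_def successively_append_iff)

lemma alternates_map:
  assumes "\<And>x. (f x < q) = (x < p)"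
  shows "alternates q (map f xs) = alternates p xs"
  by (simp add: alternates_def successively_map assms)

text \<open>Reflection exchanges the two sides: \<open>c - x < c + 1 - p\<close> holds exactly when
  \<open>p \<le> x\<close>.\<close>

lemma alternates_map_reflect: "alternates (c + 1 - p) (map (\<lambda>x. c - x) xs) = alternates p xs"
  unfolding alternates_def successively_map
  by (rule arg_cong2[of _ _ _ _ successively]) (auto simp: fun_eq_iff)

lemma alternates_rev [simp]: "alternates p (rev xs) = alternates p xs"
  unfolding alternates_def successively_rev
  by (rule arg_cong2[of _ _ _ _ successively]) (auto simp: fun_eq_iff)

lemma map_close: "c \<noteq> [] \<Longrightarrow> map f c @ [hd (map f c)] = map f (c @ [hd c])"
  by (simp add: hd_map)

lemma labels_append: "labels (P @ Q) (cs @ ds) = labels P cs \<union> labels Q ds"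
  by (auto simp: labels_def)

lemma labels_map: "labels (map f P) (map (map f) cs) = f ` labels P cs"
  by (auto simp: labels_def)

lemma differences_append:
  "P \<noteq> [] \<Longrightarrow> Q \<noteq> [] \<Longrightarrow>
    differences (P @ Q) (cs @ ds) = insert \<bar>last P - hd Q\<bar> (differences P cs \<union> differences Q ds)"
  by (auto simp: differences_def diffs_append)

lemma differences_spread:
  assumes "crossing p P cs" "a \<le> b" "[] \<notin> set cs"
  shows "differences (map (spread a b p) P) (map (map (spread a b p)) cs) = (\<lambda>d. d + (b - a)) ` differences P cs"
proof -
  have *: "diffs (map (spread a b p) c @ [hd (map (spread a b p) c)]) = (\<lambda>d. d + (b - a)) ` diffs (c @ [hd c])"
    if "c \<in> set cs" for c
  proof -
    have "c \<noteq> []" "alternates p (c @ [hd c])"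
      using that assms by (auto simp: crossing_def)
    then show ?thesis
      using assms(2) map_close[of c "spread a b p"] diffs_spread[of p "c @ [hd c]" a b] by metis
  qed
  have "(\<Union>c\<in>set (map (map (spread a b p)) cs). diffs (c @ [hd c])) = (\<Union>c\<in>set cs. (\<lambda>d. d + (b - a)) ` diffs (c @ [hd c]))"
    using * by simp
  then show ?thesis
    using assms by (simp add: differences_def diffs_spread crossing_def image_Un image_UN)
qed

lemma differences_map:
  assumes "\<And>xs. diffs (map f xs) = diffs xs" "[] \<notin> set cs"
  shows "differences (map f P) (map (map f) cs) = differences P cs"
proof -
  have "diffs (map f c @ [hd (map f c)]) = diffs (c @ [hd c])" if "c \<in> set cs" for c
  proof -
    have "c \<noteq> []" using that assms(2) by auto
    then show ?thesis using map_close[of c f] assms(1)[of "c @ [hd c]"] by metis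
  qed
  then show ?thesis
    by (simp add: differences_def assms(1))
qed

lemma labels_rev [simp]: "labels (rev P) cs = labels P cs"
  by (simp add: labels_def)

lemma differences_rev [simp]: "differences (rev P) cs = differences P cs"
  by (simp add: differences_def)

lemma labelled_rev: "labelled M n P cs \<Longrightarrow> labelled M n (rev P) cs"
  by (simp add: labelled_def)

lemma labelled_pos: "labelled M n P cs \<Longrightarrow> n > 0"
proof -
  assume "labelled M n P cs"
  then have "length P > 0" "int (length P) + int (sum_mset M) = n"
    unfolding labelled_def by (blast intro: length_greater_0_conv[THEN iffD2])+
  then show ?thesis by linarith
qed

lemma length_comp_map [simp]: "length \<circ> map f = length"
  by (simp add: fun_eq_iff)

lemma labelled_reflect:
  assumes "labelled M n P cs"
  shows "labelled M n (map (\<lambda>x. n - 1 - x) P) (map (map (\<lambda>x. n - 1 - x)) cs)"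
proof -
  have "x \<in> (\<lambda>x. n - 1 - x) ` labels P cs" if "x \<in> {0..<n}" for x
  proof -
    have "n - 1 - x \<in> labels P cs"
      using that assms by (auto simp: labelled_def)
    then show ?thesis by (rule rev_image_eqI) simp
  qed
  moreover have "[] \<notin> set (map (map (\<lambda>x. n - 1 - x)) cs)"
    using assms by (auto simp: labelled_def)
  ultimately show ?thesis
    using assms unfolding labelled_def labels_map
    by (subst differences_map) auto
qed

lemma crossing_reflect:
  assumes "crossing p P cs" "[] \<notin> set cs"
  shows "crossing (n - p) (map (\<lambda>x. n - 1 - x) P) (map (map (\<lambda>x. n - 1 - x)) cs)"
proof -
  have "alternates (n - p) (map (\<lambda>x. n - 1 - x) xs) = alternates p xs" for xs
    using alternates_map_reflect[of "n - 1" p xs] by simp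
  then show ?thesis
    using assms unfolding crossing_def
    by (auto simp: map_close simp del: map_append) (metis map_close)
qed

text \<open>Here \<open>D\<close> is the number of vertices of \<open>Q\<close>. The differences of
  \<open>Q\<close> fill \<open>1, ..., D - 1\<close>, the link supplies \<open>D\<close>, and the
  differences of \<open>P\<close>, raised by \<open>D\<close>, fill the rest. The labels of
  \<open>Q\<close> fill the gap opened at \<open>p\<close>.\<close>

lemma labelled_stack:
  assumes P: "labelled M n P cs" "crossing p P cs" "0 \<le> p" "p \<le> n" and Q: "labelled M' D Q ds"
    and join: "\<bar>spread 0 D p (last P) - (hd Q + p)\<bar> = D"
  shows "labelled (M + M') (n + D) (map (spread 0 D p) P @ map (\<lambda>x. x + p) Q)
           (map (map (spread 0 D p)) cs @ map (map (\<lambda>x. x + p)) ds)"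
    (is "labelled _ _ (?P @ ?Q) (?cs @ ?ds)")
proof -
  have D: "D > 0" using Q by (rule labelled_pos)
  have ne: "P \<noteq> []" "Q \<noteq> []" "[] \<notin> set cs" "[] \<notin> set ds"
    using P Q by (auto simp: labelled_def)
  have V: "labels (?P @ ?Q) (?cs @ ?ds) = spread 0 D p ` labels P cs \<union> (\<lambda>x. x + p) ` labels Q ds"
    by (simp only: labels_append labels_map)
  have "{0..<n + D} \<subseteq> labels (?P @ ?Q) (?cs @ ?ds)"
  proof
    fix x assume x: "x \<in> {0..<n + D}"
    consider "x < p" | "p \<le> x" "x < p + D" | "p + D \<le> x" by linarith
    then show "x \<in> labels (?P @ ?Q) (?cs @ ?ds)"
    proof cases
      case 1
      then have "x \<in> labels P cs" using x P by (auto simp: labelled_def)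
      then have "spread 0 D p x \<in> spread 0 D p ` labels P cs" by (rule imageI)
      then show ?thesis unfolding V using 1 by (simp add: spread_def)
    next
      case 2
      then have "x - p \<in> labels Q ds" using Q by (auto simp: labelled_def)
      then show ?thesis unfolding V by (auto intro!: rev_image_eqI)
    next
      case 3
      then have "x - D \<in> labels P cs" using x P by (auto simp: labelled_def)
      then have "spread 0 D p (x - D) \<in> spread 0 D p ` labels P cs" by (rule imageI)
      then show ?thesis unfolding V using 3 by (simp add: spread_def)
    qed
  qed
  moreover have E: "differences (?P @ ?Q) (?cs @ ?ds) = insert D ((\<lambda>d. d + D) ` differences P cs \<union> differences Q ds)"
  proof -
    have "differences ?P ?cs = (\<lambda>d. d + D) ` differences P cs"
      using differences_spread[OF P(2), of 0 D] D ne by simp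
    moreover have "differences ?Q ?ds = differences Q ds"
      using ne by (intro differences_map) auto
    ultimately show ?thesis
      using ne join by (subst differences_append) (auto simp: last_map hd_map)
  qed
  have "{1..<n + D} \<subseteq> differences (?P @ ?Q) (?cs @ ?ds)"
  proof
    fix d assume d: "d \<in> {1..<n + D}"
    consider "d < D" | "d = D" | "d > D" by linarith
    then show "d \<in> differences (?P @ ?Q) (?cs @ ?ds)"
    proof cases
      case 1
      then show ?thesis unfolding E using d Q by (auto simp: labelled_def)
    next
      case 2
      then show ?thesis unfolding E by simp
    next
      case 3
      then have "d - D \<in> differences P cs" using d P by (auto simp: labelled_def)
      then have "d - D + D \<in> (\<lambda>d. d + D) ` differences P cs" by (rule imageI)
      then show ?thesis unfolding E by simp
    qed
  qed
  moreover have "mset (map length (?cs @ ?ds)) = M + M'" "[] \<notin> set (?cs @ ?ds)"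
    using P Q by (auto simp: labelled_def)
  moreover have "int (length (?P @ ?Q)) + int (sum_mset (M + M')) = n + D"
    using P Q by (auto simp: labelled_def)
  ultimately show ?thesis
    using ne by (auto simp: labelled_def)
qed

text \<open>The low labels of the stack are the \<open>p\<close> low ones of the outer block and
  then the \<open>p'\<close> low ones of the inner block.\<close>

lemma crossing_stack:
  assumes P: "crossing p P cs" and Q: "crossing p' Q ds" and D: "0 \<le> p'" "p' \<le> D" "D > 0"
    and ne: "P \<noteq> []" "Q \<noteq> []" "[] \<notin> set cs" "[] \<notin> set ds"
    and join: "(last P < p) \<noteq> (hd Q < p')"
  shows "crossing (p + p') (map (spread 0 D p) P @ map (\<lambda>x. x + p) Q)
           (map (map (spread 0 D p)) cs @ map (map (\<lambda>x. x + p)) ds)"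
proof -
  have s: "(spread 0 D p x < p + p') = (x < p)" for x
    using D by (auto simp: spread_def)
  have t: "(x + p < p + p') = (x < p')" for x by auto
  note b = alternates_map[of "spread 0 D p", OF s] alternates_map[of "\<lambda>x. x + p", OF t]
  have "alternates (p + p') (map (spread 0 D p) c @ [hd (map (spread 0 D p) c)])" if "c \<in> set cs" for c
  proof -
    have "c \<noteq> []" "alternates p (c @ [hd c])" using that P ne by (auto simp: crossing_def)
    then show ?thesis using map_close[of c "spread 0 D p"] b(1)[of "c @ [hd c]"] by metis
  qed
  moreover have "alternates (p + p') (map (\<lambda>x. x + p) c @ [hd (map (\<lambda>x. x + p) c)])" if "c \<in> set ds" for c
  proof -
    have "c \<noteq> []" "alternates p' (c @ [hd c])" using that Q ne by (auto simp: crossing_def)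
    then show ?thesis using map_close[of c "\<lambda>x. x + p"] b(2)[of "c @ [hd c]"] by metis
  qed
  moreover have "alternates (p + p') (map (spread 0 D p) P @ map (\<lambda>x. x + p) Q)"
    using P Q ne join s[of "last P"] by (auto simp: alternates_append_iff b crossing_def last_map hd_map)
  ultimately show ?thesis
    by (auto simp: crossing_def)
qed

section \<open>Exchanging the ends of a block and stacking blocks\<close>

lemma graceful_from_reflect: "graceful_from M n r \<Longrightarrow> graceful_from M n (n - r)"
proof -
  assume "graceful_from M n r"
  then obtain P cs where P: "labelled M (n + 1) P cs" "hd P = r" by (auto simp: graceful_from_def)
  then have "hd (map (\<lambda>x. n - x) P) = n - r" by (auto simp: hd_map labelled_def)
  moreover have "labelled M (n + 1) (map (\<lambda>x. n - x) P) (map (map (\<lambda>x. n - x)) cs)"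
    using labelled_reflect[OF P(1)] by simp
  ultimately show ?thesis by (auto simp: graceful_from_def)
qed

lemma alpha_block_imp_graceful_from: "alpha_block M n r \<Longrightarrow> graceful_from M (n - 1) r"
  by (auto simp: alpha_block_def graceful_from_def)

lemma ablkE:
  assumes "alpha_block M n r"
  obtains (even) h P cs where "n = 2 * h" "0 \<le> r" "r < h" "labelled M n P cs" "crossing h P cs" "hd P = r" "last P = h + r"
  | (odd) h P cs where "n = 2 * h - 1" "0 \<le> r" "r < h" "labelled M n P cs" "crossing h P cs" "hd P = r" "last P = h - 1 - r"
proof (cases "even n")
  case True
  then obtain h where "n = 2 * h" by (elim evenE)
  moreover from this have "(n + 1) div 2 = h" "n div 2 = h" by simp_all
  ultimately show ?thesis
    using assms that(1)[of h] by (auto simp: alpha_block_def)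
next
  case False
  then obtain h' where "n = 2 * h' + 1" by (elim oddE)
  moreover from this have "(n + 1) div 2 = h' + 1" by simp
  ultimately show ?thesis
    using assms that(2)[of "h' + 1"] by (auto simp: alpha_block_def algebra_simps)
qed

lemma alpha_block_evenI:
  "labelled M (2 * h) P cs \<Longrightarrow> crossing h P cs \<Longrightarrow> hd P = r \<Longrightarrow> last P = h + r \<Longrightarrow> 0 \<le> r \<Longrightarrow> r < h \<Longrightarrow> alpha_block M (2 * h) r"
  by (auto simp: alpha_block_def)

lemma alpha_block_oddI:
  "labelled M (2 * h - 1) P cs \<Longrightarrow> crossing h P cs \<Longrightarrow> hd P = r \<Longrightarrow> last P = h - 1 - r \<Longrightarrow> 0 \<le> r \<Longrightarrow> r < h
    \<Longrightarrow> alpha_block M (2 * h - 1) r"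
  by (auto simp: alpha_block_def)

text \<open>For odd \<open>n\<close> both ends are low and reversing the path is enough. For even
  \<open>n\<close> the reversed path starts at \<open>h + r\<close>, which the complement
  \<open>x \<mapsto> 2 * h - 1 - x\<close> sends to \<open>h - 1 - r\<close>.\<close>

lemma alpha_block_swap:
  assumes "alpha_block M n r"
  shows "alpha_block M n ((n + 1) div 2 - 1 - r)"
  using assms
proof (cases rule: ablkE)
  case (even h P cs)
  let ?f = "\<lambda>x. 2 * h - 1 - x"
  have ne: "P \<noteq> []" "[] \<notin> set cs" using even by (auto simp: labelled_def)
  have "alpha_block M (2 * h) (h - 1 - r)"
  proof (rule alpha_block_evenI)
    show "labelled M (2 * h) (map ?f (rev P)) (map (map ?f) cs)"
      using labelled_reflect[OF labelled_rev[of M n P cs]] even by simp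
    have "crossing h (rev P) cs" using even by (simp add: crossing_def)
    from crossing_reflect[OF this ne(2), of "2 * h"] show "crossing h (map ?f (rev P)) (map (map ?f) cs)" by simp
    show "hd (map ?f (rev P)) = h - 1 - r" "last (map ?f (rev P)) = h + (h - 1 - r)"
      using even ne by (auto simp: hd_map last_map hd_rev last_rev)
  qed (use even in auto)
  then show ?thesis using even by simp
next
  case (odd h P cs)
  have "alpha_block M (2 * h - 1) (h - 1 - r)"
    by (rule alpha_block_oddI[of _ _ "rev P" cs])
      (use odd in \<open>auto simp: labelled_rev crossing_def hd_rev last_rev\<close>)
  then show ?thesis using odd by simp
qed

text \<open>The link has difference \<open>D + 1\<close>: for even \<open>n\<close> it runs from
  \<open>h + r + D + 1\<close> to \<open>h + r\<close>; for odd \<open>n\<close> the inner labelling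
  is reflected first and the link runs from \<open>h - 1 - r\<close> to
  \<open>h + D - r\<close>.\<close>

lemma alpha_block_stack_graceful_from:
  assumes "alpha_block M n r" "graceful_from M' D r"
  shows "graceful_from (M + M') (n + D) r"
  using assms(1)
proof (cases rule: ablkE)
  case (even h P cs)
  obtain Q ds where Q: "labelled M' (D + 1) Q ds" "hd Q = r" using assms(2) by (auto simp: graceful_from_def)
  have "P \<noteq> []" using even by (auto simp: labelled_def)
  have "labelled (M + M') (n + (D + 1)) (map (spread 0 (D + 1) h) P @ map (\<lambda>x. x + h) Q)
           (map (map (spread 0 (D + 1) h)) cs @ map (map (\<lambda>x. x + h)) ds)"
    by (rule labelled_stack) (use even Q labelled_pos[OF Q(1)] in \<open>auto simp: spread_def\<close>)
  moreover have "hd (map (spread 0 (D + 1) h) P @ map (\<lambda>x. x + h) Q) = r"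
    using \<open>P \<noteq> []\<close> even by (simp add: hd_map spread_def)
  ultimately show ?thesis by (auto simp: graceful_from_def add.assoc)
next
  case (odd h P cs)
  obtain Q ds where Q: "labelled M' (D + 1) Q ds" "hd Q = D - r"
    using graceful_from_reflect[OF assms(2)] by (auto simp: graceful_from_def)
  have "P \<noteq> []" using odd by (auto simp: labelled_def)
  have "labelled (M + M') (n + (D + 1)) (map (spread 0 (D + 1) h) P @ map (\<lambda>x. x + h) Q)
           (map (map (spread 0 (D + 1) h)) cs @ map (map (\<lambda>x. x + h)) ds)"
    by (rule labelled_stack) (use odd Q labelled_pos[OF Q(1)] in \<open>auto simp: spread_def\<close>)
  moreover have "hd (map (spread 0 (D + 1) h) P @ map (\<lambda>x. x + h) Q) = r"
    using \<open>P \<noteq> []\<close> odd by (simp add: hd_map spread_def)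
  ultimately show ?thesis by (auto simp: graceful_from_def add.assoc)
qed

lemma alpha_block_stack:
  assumes "alpha_block M n r" "alpha_block M' n' r"
  shows "alpha_block (M + M') (n + n') r"
proof -
  \<comment> \<open>The common core of the four parity cases. \<open>h'\<close> is the threshold of
    the inner block as inserted, possibly after reflection; \<open>4\<close> records the parity of
    the total and the resulting end.\<close>
  have *: "alpha_block (M + M') (n + n') r"
    if 1: "labelled M n P cs" "crossing h P cs" "hd P = r" "0 \<le> r" "r < h" "h \<le> n"
      and 2: "labelled M' n' Q ds" "crossing h' Q ds" "0 \<le> h'" "h' \<le> n'"
      and 3: "\<bar>spread 0 n' h (last P) - (hd Q + h)\<bar> = n'" "(last P < h) \<noteq> (hd Q < h')"
      and 4: "n + n' = 2 * (h + h') \<and> last Q + h = (h + h') + r \<or>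
        n + n' = 2 * (h + h') - 1 \<and> last Q + h = (h + h') - 1 - r" for P cs Q ds h h'
  proof -
    let ?P = "map (spread 0 n' h) P @ map (\<lambda>x. x + h) Q"
    let ?cs = "map (map (spread 0 n' h)) cs @ map (map (\<lambda>x. x + h)) ds"
    have ne: "P \<noteq> []" "Q \<noteq> []" "[] \<notin> set cs" "[] \<notin> set ds" and n': "n' > 0"
      using 1 2 labelled_pos[OF 2(1)] by (auto simp: labelled_def)
    have l: "labelled (M + M') (n + n') ?P ?cs" by (rule labelled_stack) (use 1 2 3 in auto)
    have a: "crossing (h + h') ?P ?cs" by (rule crossing_stack) (use 1 2 3 ne n' in auto)
    have hl: "hd ?P = r" "last ?P = last Q + h"
      using ne 1 by (auto simp: hd_map last_map spread_def)
    show ?thesis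
      using 4
    proof
      assume "n + n' = 2 * (h + h') \<and> last Q + h = (h + h') + r"
      then show ?thesis using alpha_block_evenI[of "M + M'" "h + h'" ?P ?cs r] l a hl 1 2 by auto
    next
      assume "n + n' = 2 * (h + h') - 1 \<and> last Q + h = (h + h') - 1 - r"
      then show ?thesis using alpha_block_oddI[of "M + M'" "h + h'" ?P ?cs r] l a hl 1 2 by auto
    qed
  qed
  show ?thesis
    using assms(1)
  proof (cases rule: ablkE)
    case (even h P cs)
    note e = this
    show ?thesis
      using assms(2)
    proof (cases rule: ablkE)
      case (even h' Q ds)
      then show ?thesis by (intro *[of P cs h Q ds h']) (use e in \<open>auto simp: spread_def\<close>)
    next
      case (odd h' Q ds)
      then show ?thesis by (intro *[of P cs h Q ds h']) (use e in \<open>auto simp: spread_def\<close>)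
    qed
  next
    case (odd h P cs)
    note o = this
    let ?f = "\<lambda>x. n' - 1 - x"
    \<comment> \<open>The outer path now ends on the low side, so the inner block is reflected and
      its threshold becomes \<open>n' - h'\<close>.\<close>
    have **: "alpha_block (M + M') (n + n') r"
      if "labelled M' n' Q ds" "crossing h' Q ds" "hd Q = r" "r < h'" "h' \<le> n'"
        "n' = 2 * h' \<and> last Q = h' + r \<or> n' = 2 * h' - 1 \<and> last Q = h' - 1 - r" for h' Q ds
    proof -
      have "Q \<noteq> []" "[] \<notin> set ds" using that by (auto simp: labelled_def)
      then show ?thesis
        by (intro *[of P cs h "map ?f Q" "map (map ?f) ds" "n' - h'"])
          (use o that in \<open>auto simp: spread_def labelled_reflect crossing_reflect hd_map last_map\<close>)
    qed
    show ?thesis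
      using assms(2)
    proof (cases rule: ablkE)
      case (even h' Q ds)
      then show ?thesis by (intro **[of Q ds h']) auto
    next
      case (odd h' Q ds)
      then show ?thesis by (intro **[of Q ds h']) auto
    qed
  qed
qed

section \<open>Zigzags, paths and even cycles\<close>

text \<open>The list \<open>a, b, a + 1, b - 1, ...\<close> of \<open>n\<close> entries.\<close>

definition zig :: "int \<Rightarrow> int \<Rightarrow> int \<Rightarrow> int list" where
  "zig a b n = map (\<lambda>j. if even j then a + int (j div 2) else b - int (j div 2)) [0..<nat n]"

text \<open>The list \<open>a, b, a - 1, b + 1, ...\<close>, used with \<open>a\<close> on the high
  side.\<close>

definition zag :: "int \<Rightarrow> int \<Rightarrow> int \<Rightarrow> int list" where
  "zag a b n = map (\<lambda>x. a + b - x) (zig b a n)"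

lemma length_zig [simp]: "length (zig a b n) = nat n"
  and length_zag [simp]: "length (zag a b n) = nat n"
  by (simp_all add: zig_def zag_def)

lemma zig_eq_Nil_iff [simp]: "zig a b n = [] \<longleftrightarrow> n \<le> 0"
  and zag_eq_Nil_iff [simp]: "zag a b n = [] \<longleftrightarrow> n \<le> 0"
  by (simp_all add: zig_def zag_def)

lemma zig_nth: "j < nat n \<Longrightarrow> zig a b n ! j = (if even j then a + int (j div 2) else b - int (j div 2))"
  by (simp add: zig_def)

lemma set_zig:
  "{a..<a + (n + 1) div 2} \<union> {b - n div 2<..b} \<subseteq> set (zig a b n)"
proof -
  have "x \<in> set (zig a b n)" if x: "a \<le> x" "x < a + (n + 1) div 2" for x
  proof -
    define j where "j = nat (2 * (x - a))"
    have j: "int j = 2 * (x - a)" using x by (simp add: j_def)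
    then have "even (int j)" by simp
    then have "even j" by simp
    moreover have "int (j div 2) = x - a" using j by (simp add: zdiv_int)
    moreover have "int j < n" using x j by presburger
    moreover from this have "j < nat n" by simp
    ultimately have "x = zig a b n ! j" "j < length (zig a b n)" by (auto simp: zig_nth)
    then show ?thesis by (metis nth_mem)
  qed
  moreover have "x \<in> set (zig a b n)" if x: "b - n div 2 < x" "x \<le> b" for x
  proof -
    define j where "j = nat (2 * (b - x) + 1)"
    have j: "int j = 2 * (b - x) + 1" using x by (simp add: j_def)
    then have "odd (int j)" by simp
    then have "odd j" by simp
    moreover have "int (j div 2) = b - x" using j by (simp add: zdiv_int)
    moreover have "int j < n" using x j by presburger
    moreover from this have "j < nat n" by simp
    ultimately have "x = zig a b n ! j" "j < length (zig a b n)" by (auto simp: zig_nth)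
    then show ?thesis by (metis nth_mem)
  qed
  ultimately show ?thesis by auto
qed

lemma set_zig_even: "{a..<a + h} \<union> {b - h<..b} \<subseteq> set (zig a b (2 * h))"
  and set_zig_odd: "{a..a + h} \<union> {b - h<..b} \<subseteq> set (zig a b (2 * h + 1))"
proof -
  have "(2 * h + 1) div 2 = h" "(2 * h) div 2 = h" "(2 * h + 1 + 1) div 2 = h + 1" by presburger+
  then show "{a..<a + h} \<union> {b - h<..b} \<subseteq> set (zig a b (2 * h))"
    "{a..a + h} \<union> {b - h<..b} \<subseteq> set (zig a b (2 * h + 1))"
    using set_zig[of a "2 * h" b] set_zig[of a "2 * h + 1" b] by (auto simp: subset_iff)
qed

text \<open>The successive differences are \<open>b - a, b - a - 1, ...\<close>; the hypothesis
  keeps them nonnegative up to the last one.\<close>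

lemma diffs_zig:
  assumes "n \<le> b - a + 2"
  shows "{b - a - n + 2..b - a} \<subseteq> diffs (zig a b n)"
proof
  fix d assume d: "d \<in> {b - a - n + 2..b - a}"
  define j where "j = nat (b - a - d)"
  have j: "int j = b - a - d" "Suc j < nat n" using d by (auto simp: j_def)
  have "\<bar>zig a b n ! j - zig a b n ! Suc j\<bar> = b - a - int j"
  proof (cases "even j")
    case True
    then obtain i where "j = 2 * i" by (elim evenE)
    then show ?thesis using j assms by (auto simp: zig_nth)
  next
    case False
    then obtain i where "j = 2 * i + 1" by (elim oddE)
    then show ?thesis using j assms by (auto simp: zig_nth)
  qed
  then have "d = \<bar>zig a b n ! j - zig a b n ! Suc j\<bar>" using j by simp
  then show "d \<in> diffs (zig a b n)" using j unfolding diffs_def by auto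
qed

lemma hd_zig [simp]: "n > 0 \<Longrightarrow> hd (zig a b n) = a"
  by (simp add: hd_conv_nth zig_nth)

lemma last_zig: "n > 0 \<Longrightarrow> last (zig a b n) = (if even n then b + 1 - n div 2 else a + n div 2)"
proof -
  assume n: "n > 0"
  then have l: "last (zig a b n) = zig a b n ! (nat n - 1)" by (simp add: last_conv_nth)
  show ?thesis
  proof (cases "even n")
    case True
    then obtain h where "n = 2 * h" by (elim evenE)
    then have "nat n - 1 = 2 * (nat h - 1) + 1" "h > 0" using n by auto
    then show ?thesis using l n \<open>n = 2 * h\<close> by (simp add: zig_nth)
  next
    case False
    then obtain h where "n = 2 * h + 1" by (elim oddE)
    then have "nat n - 1 = 2 * nat h" "h \<ge> 0" using n by auto
    then show ?thesis using l n \<open>n = 2 * h + 1\<close> by (simp add: zig_nth)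
  qed
qed

lemma alternates_zig:
  assumes "n \<le> 2 * (p - a)" "n \<le> 2 * (b - p) + 3"
  shows "alternates p (zig a b n)"
  unfolding alternates_def successively_conv_nth
proof (intro allI impI)
  fix j assume "Suc j < length (zig a b n)"
  then show "(zig a b n ! j < p) \<noteq> (zig a b n ! Suc j < p)"
    using assms by (cases "even j") (auto simp: zig_nth elim!: evenE oddE)
qed

lemma set_zag:
  "{a - (n + 1) div 2<..a} \<union> {b..<b + n div 2} \<subseteq> set (zag a b n)"
proof -
  have "x \<in> (\<lambda>x. a + b - x) ` set (zig b a n)"
    if "x \<in> {a - (n + 1) div 2<..a} \<union> {b..<b + n div 2}" for x
  proof -
    have "a + b - x \<in> {b..<b + (n + 1) div 2} \<union> {a - n div 2<..a}" using that by auto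
    then have "a + b - x \<in> set (zig b a n)" using set_zig by blast
    then show ?thesis by (rule rev_image_eqI) simp
  qed
  then show ?thesis by (auto simp: zag_def)
qed

lemma set_zag_even: "{a - h<..a} \<union> {b..<b + h} \<subseteq> set (zag a b (2 * h))"
  and set_zag_odd: "{a - h..a} \<union> {b..<b + h} \<subseteq> set (zag a b (2 * h + 1))"
proof -
  have "(2 * h + 1) div 2 = h" "(2 * h) div 2 = h" "(2 * h + 1 + 1) div 2 = h + 1" by presburger+
  then show "{a - h<..a} \<union> {b..<b + h} \<subseteq> set (zag a b (2 * h))"
    "{a - h..a} \<union> {b..<b + h} \<subseteq> set (zag a b (2 * h + 1))"
    using set_zag[of a "2 * h" b] set_zag[of a "2 * h + 1" b] by (auto simp: subset_iff)
qed

lemma diffs_zag: "n \<le> a - b + 2 \<Longrightarrow> {a - b - n + 2..a - b} \<subseteq> diffs (zag a b n)"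
  using diffs_zig[of n a b] by (simp add: zag_def)

lemma hd_zag [simp]: "n > 0 \<Longrightarrow> hd (zag a b n) = a"
  using zig_eq_Nil_iff[of b a n] by (simp add: zag_def hd_map del: zig_eq_Nil_iff)

lemma last_zag: "n > 0 \<Longrightarrow> last (zag a b n) = (if even n then b - 1 + n div 2 else a - n div 2)"
  using zig_eq_Nil_iff[of b a n] by (simp add: zag_def last_map last_zig del: zig_eq_Nil_iff)

lemma alternates_zag:
  assumes "n \<le> 2 * (a - p) + 2" "n \<le> 2 * (p - b) + 1"
  shows "alternates p (zag a b n)"
proof -
  have "alternates (a + b + 1 - p) (zig b a n)" using assms by (intro alternates_zig) auto
  then show ?thesis using alternates_map_reflect[of "a + b" "a + b + 1 - p"] by (simp add: zag_def)
qed

text \<open>The classical labelling \<open>0, n - 1, 1, n - 2, ...\<close> of a path ends right at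
  the threshold.\<close>

lemma alpha_block_zigzag:
  assumes "n > 0"
  shows "alpha_block {#} n 0"
proof (cases "even n")
  case True
  then obtain h where h: "n = 2 * h" by (elim evenE)
  have "labelled {#} (2 * h) (zig 0 (2 * h - 1) (2 * h)) []"
    using h assms set_zig_even[of 0 h "2 * h - 1"] diffs_zig[of "2 * h" "2 * h - 1" 0]
    by (auto simp: labelled_def labels_def differences_def subset_iff)
  moreover have "crossing h (zig 0 (2 * h - 1) (2 * h)) []"
    by (auto simp: crossing_def intro!: alternates_zig)
  ultimately show ?thesis
    using h assms by (auto intro!: alpha_block_evenI simp: last_zig)
next
  case False
  then obtain h where h: "n = 2 * h + 1" by (elim oddE)
  have "labelled {#} (2 * h + 1) (zig 0 (2 * h) (2 * h + 1)) []"
    using h assms set_zig_odd[of 0 h "2 * h"] diffs_zig[of "2 * h + 1" "2 * h" 0]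
    by (auto simp: labelled_def labels_def differences_def subset_iff)
  moreover have "crossing (h + 1) (zig 0 (2 * h) (2 * h + 1)) []"
    by (auto simp: crossing_def intro!: alternates_zig)
  ultimately show ?thesis
    using h assms alpha_block_oddI[of "{#}" "h + 1" "zig 0 (2 * h) (2 * h + 1)" "[]" 0]
    by (auto simp: last_zig algebra_simps)
qed

text \<open>
  Peeling off a zigzag of \<open>2 r + 1\<close> or \<open>2 r + 2\<close> vertices and exchanging the two ends of the path
  is a Euclidean algorithm on the two end positions; it fails only when they coincide.
\<close>

lemma alpha_block_path:
  assumes "0 \<le> r" "r < (n + 1) div 2" "r = 0 \<or> n \<noteq> 4 * r + 1"
  shows "alpha_block {#} n r"
  using assms
proof (induction "nat n" arbitrary: n r rule: less_induct)
  case less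
  have main: "alpha_block {#} n r" if r: "0 < r" "2 * r \<le> (n + 1) div 2 - 1" "n \<noteq> 4 * r + 1" for r
  proof -
    \<comment> \<open>A zigzag of \<open>2 * r + 1\<close> vertices with its ends exchanged starts
      at \<open>r\<close>. It would leave the exceptional size \<open>4 * r + 1\<close> exactly when
      \<open>n = 6 * r + 2\<close>; then one more vertex is peeled off.\<close>
    define n1 where "n1 = (if n = 6 * r + 2 then 2 * r + 2 else 2 * r + 1)"
    have n: "n \<ge> 4 * r + 2" using r by linarith
    have "(n1 + 1) div 2 - 1 = r" by (auto simp: n1_def)
    then have "alpha_block {#} n1 r" using alpha_block_swap[OF alpha_block_zigzag[of n1]] r by (auto simp: n1_def split: if_splits)
    moreover have "alpha_block {#} (n - n1) r"
      by (rule less.hyps) (use n r in \<open>auto simp: n1_def\<close>)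
    ultimately show ?thesis using alpha_block_stack[of "{#}" n1 r "{#}" "n - n1"] by simp
  qed
  let ?q = "(n + 1) div 2 - 1 - r"
  have "n > 0" using less.prems by linarith
  consider "r = 0" | "?q = 0" | "0 < r" "r \<le> ?q" "n \<noteq> 4 * r + 1" | "0 < ?q" "?q < r"
    using less.prems by linarith
  then show ?case
  proof cases
    case 1 then show ?thesis using alpha_block_zigzag \<open>n > 0\<close> by simp
  next
    case 2 then show ?thesis using alpha_block_swap[OF alpha_block_zigzag[OF \<open>n > 0\<close>]] by simp
  next
    case 3 then show ?thesis by (intro main) auto
  next
    case 4
    define h where "h = (n + 1) div 2"
    have h: "2 * h \<le> n + 1" "n \<le> 2 * h" unfolding h_def by linarith+
    have q: "0 < h - 1 - r" "h - 1 - r < r" using 4 by (simp_all add: h_def)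
    \<comment> \<open>Equality would force \<open>h = 2 * (h - 1 - r) + 1\<close>, so the two end
      positions would coincide.\<close>
    have "n \<noteq> 4 * (h - 1 - r) + 1"
    proof
      assume "n = 4 * (h - 1 - r) + 1"
      with h q show False by presburger
    qed
    then have "alpha_block {#} n (h - 1 - r)" using q by (intro main) (auto simp: h_def[symmetric])
    from alpha_block_swap[OF this] show ?thesis by (simp add: h_def)
  qed
qed

section \<open>Blocks that contain even cycles\<close>

lemma labelled_single:
  assumes "P \<noteq> []" "c \<noteq> []" "int (length P) + int (length c) = n"
    "{0..<n} \<subseteq> set P \<union> set c" "{1..<n} \<subseteq> diffs P \<union> diffs (c @ [hd c])"
  shows "labelled {#length c#} n P [c]"
  using assms by (auto simp: labelled_def labels_def differences_def)

text \<open>The cycle uses all labels but \<open>a\<close>, the middle of the low half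
  \<open>0, ..., 2 * a\<close>; this label is a path without edges. The two zigzags take the large
  and the small differences, and the two edges between them give \<open>2 * a\<close> and
  \<open>2 * a + 1\<close>.\<close>

lemma alpha_block_cycle_0_mod_4:
  assumes "a \<ge> 1"
  shows "alpha_block {#4 * a#} (4 * int a + 1) (int a)"
proof -
  define A where "A = int a"
  have A: "A \<ge> 1" using assms by (simp add: A_def)
  let ?z = "zig 0 (4 * A) (2 * A)" and ?w = "zig (A + 1) (3 * A) (2 * A)"
  let ?c = "?z @ ?w"
  have d: "diffs (?c @ [hd ?c]) = {2 * A, 2 * A + 1} \<union> diffs ?z \<union> diffs ?w"
    using A by (auto simp: diffs_append last_zig)
  have "labelled {#length ?c#} (4 * A + 1) [A] [?c]"
  proof (rule labelled_single)
    show "{0..<4 * A + 1} \<subseteq> set [A] \<union> set ?c"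
    proof -
      have "{0..<4 * A + 1} \<subseteq> {A} \<union> (({0..<0 + A} \<union> {4 * A - A<..4 * A}) \<union>
        ({A + 1..<A + 1 + A} \<union> {3 * A - A<..3 * A}))" by auto
      then show ?thesis
        using set_zig_even[of 0 A "4 * A"] set_zig_even[of "A + 1" A "3 * A"] by auto
    qed
    show "{1..<4 * A + 1} \<subseteq> diffs [A] \<union> diffs (?c @ [hd ?c])"
    proof -
      have "{1..<4 * A + 1} \<subseteq> {2 * A, 2 * A + 1} \<union> {4 * A - 0 - 2 * A + 2..4 * A - 0}
        \<union> {3 * A - (A + 1) - 2 * A + 2..3 * A - (A + 1)}" by auto
      then show ?thesis
        unfolding d using diffs_zig[of "2 * A" "4 * A" 0] diffs_zig[of "2 * A" "3 * A" "A + 1"] A by auto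
    qed
  qed (use A in auto)
  moreover have "crossing (2 * A + 1) [A] [?c]"
    using A alternates_zig[of "2 * A" "2 * A + 1" 0 "4 * A"] alternates_zig[of "2 * A" "2 * A + 1" "A + 1" "3 * A"]
    by (auto simp: crossing_def alternates_append_iff last_zig alternates_def[of _ "[_]"])
  ultimately have "alpha_block {#length ?c#} (2 * (2 * A + 1) - 1) A"
    using A by (intro alpha_block_oddI) (auto simp: algebra_simps)
  then show ?thesis by (simp add: A_def nat_mult_distrib add.commute)
qed

text \<open>The two zigzags of the cycle take the differences above \<open>4 * a + 1\<close> and
  below \<open>2 * a + 1\<close>, the edges between them these two values. A path on
  \<open>2 * a\<close> vertices fills the differences in between.\<close>

lemma alpha_block_cycle_2_mod_4:
  assumes "a \<ge> 1"
  shows "alpha_block {#4 * a + 2#} (6 * int a + 2) (int a)"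
proof -
  define A where "A = int a"
  have A: "A \<ge> 1" using assms by (simp add: A_def)
  let ?z = "zag (6 * A + 1) 0 (2 * A + 1)" and ?w = "rev (zig (2 * A) (4 * A) (2 * A + 1))"
  let ?c = "?z @ ?w" and ?P = "zig A (5 * A) (2 * A)"
  have d: "diffs (?c @ [hd ?c]) = {2 * A + 1, 4 * A + 1} \<union> diffs ?z \<union> diffs ?w"
    using A by (auto simp: diffs_append last_zag last_zig hd_rev last_rev)
  have "labelled {#length ?c#} (6 * A + 2) ?P [?c]"
  proof (rule labelled_single)
    show "{0..<6 * A + 2} \<subseteq> set ?P \<union> set ?c"
    proof -
      have "{0..<6 * A + 2} \<subseteq> ({A..<A + A} \<union> {5 * A - A<..5 * A}) \<union>
        (({6 * A + 1 - A..6 * A + 1} \<union> {0..<0 + A}) \<union> ({2 * A..2 * A + A} \<union> {4 * A - A<..4 * A}))"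
        by auto
      then show ?thesis
        using set_zag_odd[of "6 * A + 1" A 0] set_zig_odd[of "2 * A" A "4 * A"]
          set_zig_even[of A A "5 * A"] by auto
    qed
    show "{1..<6 * A + 2} \<subseteq> diffs ?P \<union> diffs (?c @ [hd ?c])"
    proof -
      have "{1..<6 * A + 2} \<subseteq> {5 * A - A - 2 * A + 2..5 * A - A} \<union> ({2 * A + 1, 4 * A + 1}
        \<union> {6 * A + 1 - 0 - (2 * A + 1) + 2..6 * A + 1 - 0} \<union> {4 * A - 2 * A - (2 * A + 1) + 2..4 * A - 2 * A})"
        by auto
      then show ?thesis
        unfolding d diffs_rev using diffs_zag[of "2 * A + 1" "6 * A + 1" 0] A
          diffs_zig[of "2 * A + 1" "4 * A" "2 * A"] diffs_zig[of "2 * A" "5 * A" A] by (simp; blast)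
    qed
  qed (use A in auto)
  moreover have "crossing (3 * A + 1) ?P [?c]"
    using A alternates_zag[of "2 * A + 1" "6 * A + 1" "3 * A + 1" 0]
      alternates_zig[of "2 * A + 1" "3 * A + 1" "2 * A" "4 * A"] alternates_zig[of "2 * A" "3 * A + 1" A "5 * A"]
    by (auto simp: crossing_def alternates_append_iff last_zag last_zig hd_rev last_rev alternates_def[of _ "[_]"])
  ultimately have "alpha_block {#length ?c#} (2 * (3 * A + 1)) A"
    using A by (intro alpha_block_evenI) (auto simp: last_zig)
  moreover have "length ?c = 4 * a + 2" by (simp add: A_def)
  ultimately show ?thesis by (simp add: A_def)
qed

text \<open>
  The natural blocks of two even cycles have different end positions. Extending each by a path block and
  exchanging its ends gives them a common position \<open>r\<close>.
\<close>

lemma alpha_block_even_cycle: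
  assumes "even l" "l \<ge> 4" "3 * int l \<le> 4 * r"
  obtains n where "alpha_block {#l#} n r" "2 * r < n" "2 * n \<le> 4 * r + int l + 4"
proof -
  define a where "a = l div 4"
  have "a \<ge> 1" using assms by (simp add: a_def)
  have "l = 4 * a \<or> l = 4 * a + 2" using assms(1) unfolding a_def by presburger
  then obtain m where m: "alpha_block {#l#} m (int a)" "2 * m \<le> 3 * int l" and la: "4 * a \<le> l"
    using alpha_block_cycle_0_mod_4[OF \<open>a \<ge> 1\<close>] alpha_block_cycle_2_mod_4[OF \<open>a \<ge> 1\<close>] \<open>a \<ge> 1\<close> by fastforce
  \<comment> \<open>These are the two sizes for which exchanging the ends turns \<open>a\<close>
    into \<open>r\<close>; the larger one is used when the smaller would leave the exceptional path
    on \<open>4 * a + 1\<close> vertices. By \<open>2 * m \<le> 3 * l \<le> 4 * r\<close>, at least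
    \<open>2 * a + 1\<close> vertices remain for the path.\<close>
  define n where "n = (if 2 * (r + int a) + 1 - m = 4 * int a + 1 then 2 * (r + int a) + 2 else 2 * (r + int a) + 1)"
  have "alpha_block {#} (n - m) (int a)"
    by (rule alpha_block_path) (use m assms la in \<open>auto simp: n_def\<close>)
  then have "alpha_block {#l#} n (int a)"
    using alpha_block_stack[OF m(1)] by force
  moreover have "(n + 1) div 2 - 1 - int a = r" unfolding n_def by (simp split: if_split) presburger
  ultimately have "alpha_block {#l#} n r"
    using alpha_block_swap by metis
  then show ?thesis
    using la assms by (intro that[of n]) (auto simp: n_def)
qed

text \<open>The blocks of the single cycles share the start \<open>r\<close>, so they stack and
  their size bounds add up.\<close>

lemma alpha_block_even_cycles:
  assumes "M \<noteq> {#}" "\<And>l. l \<in># M \<Longrightarrow> even l \<and> 4 \<le> l \<and> l \<le> L" "3 * int L \<le> 4 * r"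
  shows "\<exists>n>0. alpha_block M n r \<and> 2 * n \<le> int (size M) * (4 * r + int L + 4)"
  using assms(1,2)
proof (induction M rule: multiset_induct)
  case (add l M)
  have l: "even l" "4 \<le> l" "l \<le> L" using add.prems by auto
  then obtain n where n: "alpha_block {#l#} n r" "2 * r < n" "2 * n \<le> 4 * r + int l + 4"
    using alpha_block_even_cycle[of l r] assms(3) by auto
  show ?case
  proof (cases "M = {#}")
    case True
    then show ?thesis using n l assms(3) by (intro exI[of _ n]) auto
  next
    case False
    then obtain n' where n': "n' > 0" "alpha_block M n' r" "2 * n' \<le> int (size M) * (4 * r + int L + 4)"
      using add by auto
    have "alpha_block (add_mset l M) (n + n') r" using alpha_block_stack[OF n(1) n'(2)] by simp
    then show ?thesis using n n' l assms(3)
      by (intro exI[of _ "n + n'"]) (auto simp: algebra_simps)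
  qed
qed simp

text \<open>A second exchange of ends: a path block prolongs the stacked cycles until the end
  opposite to \<open>r\<close> sits at position \<open>R\<close>, which fixes the size up to
  one.\<close>

lemma alpha_block_evens_aux:
  assumes "M \<noteq> {#}" "\<And>l. l \<in># M \<Longrightarrow> even l \<and> 4 \<le> l \<and> l \<le> L" "3 * int L \<le> 4 * r"
    and "int (size M) * (4 * r + int L + 4) \<le> 4 * R"
  shows "alpha_block M (2 * (R + r) + 1) R \<or> alpha_block M (2 * (R + r) + 2) R"
proof -
  obtain m where m: "m > 0" "alpha_block M m r" "2 * m \<le> int (size M) * (4 * r + int L + 4)"
    using alpha_block_even_cycles[OF assms(1-3)] by auto
  define n where "n = (if 2 * (R + r) + 1 - m = 4 * r + 1 then 2 * (R + r) + 2 else 2 * (R + r) + 1)"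
  have "alpha_block {#} (n - m) r"
    by (rule alpha_block_path) (use m assms in \<open>auto simp: n_def\<close>)
  then have "alpha_block M n r"
    using alpha_block_stack[OF m(2)] by force
  moreover have "(n + 1) div 2 - 1 - r = R" unfolding n_def by (simp split: if_split) presburger
  ultimately have "alpha_block M n R"
    using alpha_block_swap by metis
  then show ?thesis by (auto simp: n_def split: if_splits)
qed

text \<open>Applying the previous lemma to \<open>r\<close> and to \<open>r + 1\<close> gives two
  different sizes with the same start \<open>R\<close>. One of them leaves a final path block that
  avoids the exceptional size \<open>4 * R + 1\<close>.\<close>

lemma alpha_block_evens:
  assumes "M \<noteq> {#}" "\<And>l. l \<in># M \<Longrightarrow> even l \<and> 4 \<le> l \<and> l \<le> L" "3 * int L \<le> 4 * r"
    and R: "int (size M) * (4 * r + int L + 8) \<le> 4 * R" and n: "n \<ge> 4 * R + 2 * r + 5"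
  shows "alpha_block M n R"
proof -
  have "R \<ge> 0"
  proof -
    have "0 \<le> int (size M) * (4 * r + int L + 8)" using assms(3) by simp
    then show ?thesis using R by linarith
  qed
  have "int (size M) * (4 * r + int L + 4) \<le> int (size M) * (4 * r + int L + 8)"
    by (rule mult_left_mono) auto
  then have "alpha_block M (2 * (R + r) + 1) R \<or> alpha_block M (2 * (R + r) + 2) R"
    using assms by (intro alpha_block_evens_aux) auto
  moreover have "alpha_block M (2 * (R + (r + 1)) + 1) R \<or> alpha_block M (2 * (R + (r + 1)) + 2) R"
    using assms by (intro alpha_block_evens_aux) (auto simp: algebra_simps)
  ultimately obtain m m' where m: "alpha_block M m R" "m \<in> {2 * (R + r) + 1..2 * (R + r) + 2}"
    and m': "alpha_block M m' R" "m' \<in> {2 * (R + r) + 3..2 * (R + r) + 4}"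
    by force
  define k where "k = (if n - m = 4 * R + 1 then m' else m)"
  have "alpha_block {#} (n - k) R"
    by (rule alpha_block_path) (use m m' n \<open>R \<ge> 0\<close> in \<open>auto simp: k_def\<close>)
  moreover have "alpha_block M k R" using m m' by (simp add: k_def)
  ultimately show ?thesis using alpha_block_stack[of M k R "{#}" "n - k"] by simp
qed

section \<open>Odd cycles\<close>

lemmas interval_cover = subset_iff Un_iff insert_iff empty_iff atLeastLessThan_iff atLeastAtMost_iff
  greaterThanAtMost_iff

text \<open>The exceptional size \<open>4 * k + 1\<close> is odd, so with \<open>2 * h\<close>
  vertices every start \<open>k < h\<close> is available.\<close>

lemma alpha_block_pathE:
  assumes "0 \<le> k" "k < h"
  obtains Q where "int (length Q) = 2 * h" "{0..<2 * h} \<subseteq> set Q" "{1..<2 * h} \<subseteq> diffs Q"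
    "alternates h Q" "hd Q = k" "last Q = h + k"
proof -
  have "2 * h \<noteq> 4 * k + 1" by presburger
  then have "alpha_block {#} (2 * h) k" using assms by (intro alpha_block_path) auto
  then obtain Q cs where Q: "labelled {#} (2 * h) Q cs" "crossing h Q cs" "hd Q = k" "last Q = h + k"
    by (auto simp: alpha_block_def)
  then have "cs = []" by (auto simp: labelled_def)
  then show ?thesis
    using Q that[of Q] by (auto simp: labelled_def crossing_def labels_def differences_def)
qed

text \<open>A path block with its halves moved apart by \<open>spread\<close>, to be used as a strip
  whose ends can be prescribed through \<open>k\<close>.\<close>

lemma placed_path_low:
  assumes "0 \<le> k" "k < h" "a \<le> b"
  obtains B where "int (length B) = 2 * h" "{a..<a + h} \<subseteq> set B" "{b + h..<b + 2 * h} \<subseteq> set B"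
    "{b - a + 1..<b - a + 2 * h} \<subseteq> diffs B" "hd B = a + k" "last B = b + h + k" "B \<noteq> []"
proof -
  obtain Q where Q: "int (length Q) = 2 * h" "{0..<2 * h} \<subseteq> set Q" "{1..<2 * h} \<subseteq> diffs Q"
    "alternates h Q" "hd Q = k" "last Q = h + k"
    using alpha_block_pathE[OF assms(1,2)] by blast
  let ?B = "map (spread a b h) Q"
  have ne: "Q \<noteq> []" using Q(1) assms by auto
  have s: "spread a b h x \<in> set ?B" if "x \<in> {0..<2 * h}" for x
    using that Q(2) by auto
  have "x \<in> set ?B" if "x \<in> {a..<a + h}" for x
    using s[of "x - a"] that by (auto simp: spread_def)
  then have "{a..<a + h} \<subseteq> set ?B" by blast
  moreover have "x \<in> set ?B" if "x \<in> {b + h..<b + 2 * h}" for x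
    using s[of "x - b"] that assms by (auto simp: spread_def)
  then have "{b + h..<b + 2 * h} \<subseteq> set ?B" by blast
  moreover have "x \<in> diffs ?B" if "x \<in> {b - a + 1..<b - a + 2 * h}" for x
  proof -
    have "x - (b - a) \<in> diffs Q" using Q(3) that by auto
    then have "x - (b - a) + (b - a) \<in> (\<lambda>d. d + (b - a)) ` diffs Q" by (rule imageI)
    then show ?thesis using diffs_spread[OF Q(4) assms(3)] by simp
  qed
  ultimately show ?thesis
    using Q ne assms by (intro that[of ?B]) (auto simp: hd_map last_map spread_def simp del: set_map)
qed

text \<open>Reflection in \<open>a + b + 2 * h - 1\<close> exchanges the two label intervals of the
  strip, so that it starts on the high side.\<close>

lemma placed_path_high:
  assumes "0 \<le> k" "k < h" "a \<le> b"
  obtains B where "int (length B) = 2 * h" "{a..<a + h} \<subseteq> set B" "{b + h..<b + 2 * h} \<subseteq> set B"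
    "{b - a + 1..<b - a + 2 * h} \<subseteq> diffs B" "hd B = b + 2 * h - 1 - k" "last B = a + h - 1 - k" "B \<noteq> []"
proof -
  obtain B where B: "int (length B) = 2 * h" "{a..<a + h} \<subseteq> set B" "{b + h..<b + 2 * h} \<subseteq> set B"
    "{b - a + 1..<b - a + 2 * h} \<subseteq> diffs B" "hd B = a + k" "last B = b + h + k" "B \<noteq> []"
    using placed_path_low[OF assms] by blast
  let ?c = "a + b + 2 * h - 1"
  let ?B = "map (\<lambda>x. ?c - x) B"
  have "x \<in> set ?B" if "x \<in> {a..<a + h} \<union> {b + h..<b + 2 * h}" for x
  proof -
    have "?c - x \<in> set B" using that B(2,3) by auto
    then have "?c - (?c - x) \<in> (\<lambda>x. ?c - x) ` set B" by (rule imageI)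
    then show ?thesis by simp
  qed
  then show ?thesis
    using B by (intro that[of ?B]) (auto simp: hd_map last_map)
qed

lemma set_zig_full:
  assumes "n = b - a + 1"
  shows "{a..b} \<subseteq> set (zig a b n)"
proof -
  have "x < a + (n + 1) div 2 \<or> b - n div 2 < x" for x using assms by linarith
  then have "{a..b} \<subseteq> {a..<a + (n + 1) div 2} \<union> {b - n div 2<..b}"
    by (metis UnCI atLeastAtMost_iff atLeastLessThan_iff greaterThanAtMost_iff subsetI)
  then show ?thesis using set_zig by blast
qed

text \<open>
  In both base cases the strip \<open>p1\<close> starts at the outermost labels, then come the zigzag \<open>Z\<close> of the cycle,
  the block \<open>B\<close>, and the strips \<open>t1\<close>, \<open>t2\<close>. The last vertex of the cycle is the label skipped between
  \<open>t1\<close> and \<open>t2\<close>; the difference lost by skipping it is that of the edge inside the low half.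
\<close>

lemma odd_base1:
  fixes k :: nat
  defines "K \<equiv> int k"
  assumes k: "k \<ge> 1" and g: "g \<ge> 2 * K + 1"
  shows "graceful_from {#2 * k + 1#} (8 * g - 3 * K) (2 * g - K)"
proof -
  \<comment> \<open>With this \<open>N\<close> the difference \<open>N - 6 * g + 2 * K\<close>,
    missing between \<open>t1\<close> and \<open>t2\<close>, equals \<open>2 * g - K\<close>, that
    of the low edge from \<open>3 * g - K\<close> to \<open>g\<close>.\<close>
  define N where "N = 8 * g - 3 * K"
  have K: "K \<ge> 1" using k by (simp add: K_def)
  \<comment> \<open>The offset \<open>K\<close> gives the link from \<open>g + 2 * K\<close> to the
    end \<open>N - g\<close> of \<open>p1\<close> the difference \<open>N - 2 * g - 2 * K\<close>,
    just between those of \<open>B\<close> and of \<open>Z\<close>.\<close>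
  obtain B where B: "int (length B) = 2 * (g - K)" "{g + K..<2 * g} \<subseteq> set B"
    "{N - 2 * g..<N - g - K} \<subseteq> set B" "{N - 4 * g + 1..<N - 2 * g - 2 * K} \<subseteq> diffs B"
    "hd B = g + 2 * K" "last B = N - 2 * g + K" "B \<noteq> []"
    by (rule placed_path_low[of K "g - K" "g + K" "N - 3 * g + K"]) (use K g in \<open>auto simp: N_def algebra_simps\<close>)
  define p1 where "p1 = zag N 0 (2 * g + 1)"
  define t1 where "t1 = zig (2 * g) (N - 2 * g - 1) (2 * (g - K))"
  define t2 where "t2 = zig (3 * g - K + 1) (N - 3 * g + K - 1) (2 * g - K - 1)"
  define Z where "Z = zig g (N - g - 1) (2 * K)"
  have p1: "{N - g..N} \<union> {0..<g} \<subseteq> set p1" "{N - 2 * g + 1..N} \<subseteq> diffs p1" "hd p1 = N" "last p1 = N - g" "p1 \<noteq> []"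
    using set_zag_odd[of N g 0] diffs_zag[of "2 * g + 1" N 0] K g
    by (auto simp: p1_def N_def last_zag)
  have t1: "{2 * g..<3 * g - K} \<union> {N - 3 * g + K..<N - 2 * g} \<subseteq> set t1"
    "{N - 6 * g + 2 * K + 1..N - 4 * g - 1} \<subseteq> diffs t1" "hd t1 = 2 * g" "last t1 = N - 3 * g + K" "t1 \<noteq> []"
    using set_zig_even[of "2 * g" "g - K" "N - 2 * g - 1"] diffs_zig[of "2 * (g - K)" "N - 2 * g - 1" "2 * g"] K g
    by (auto simp: t1_def N_def last_zig)
  have t2: "{3 * g - K + 1..<N - 3 * g + K} \<subseteq> set t2" "{1..N - 6 * g + 2 * K - 2} \<subseteq> diffs t2"
    "hd t2 = 3 * g - K + 1" "t2 \<noteq> []"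
    using set_zig_full[of "2 * g - K - 1" "N - 3 * g + K - 1" "3 * g - K + 1"]
      diffs_zig[of "2 * g - K - 1" "N - 3 * g + K - 1" "3 * g - K + 1"] K g
    by (auto simp: t2_def N_def)
  have Z: "{g..<g + K} \<union> {N - g - K..<N - g} \<subseteq> set Z" "{N - 2 * g - 2 * K + 1..N - 2 * g - 1} \<subseteq> diffs Z"
    "hd Z = g" "last Z = N - g - K" "Z \<noteq> []"
    using set_zig_even[of g K "N - g - 1"] diffs_zig[of "2 * K" "N - g - 1" g] K g
    by (auto simp: Z_def N_def last_zig)
  let ?P = "rev B @ rev p1 @ t1 @ t2" and ?c = "Z @ [3 * g - K]"
  have "labelled {#length ?c#} (N + 1) ?P [?c]"
  proof (rule labelled_single)
    have "int (length t2) = 2 * g - K - 1" "int (length t1) = 2 * (g - K)" "int (length p1) = 2 * g + 1"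
      "int (length Z) = 2 * K"
      using K g by (simp_all add: t1_def t2_def p1_def Z_def)
    then show "int (length ?P) + int (length ?c) = N + 1"
      using B(1) by (simp add: N_def)
    have "{0..<N + 1} \<subseteq> {g + K..<2 * g} \<union> {N - 2 * g..<N - g - K} \<union> ({N - g..N} \<union> {0..<g}) \<union>
      ({2 * g..<3 * g - K} \<union> {N - 3 * g + K..<N - 2 * g}) \<union> {3 * g - K + 1..<N - 3 * g + K} \<union>
      ({g..<g + K} \<union> {N - g - K..<N - g}) \<union> {3 * g - K}"
      unfolding interval_cover by (smt (verit))
    also have "\<dots> \<subseteq> set ?P \<union> set ?c"
      using B(2,3) p1(1) t1(1) t2(1) Z(1) by (simp only: set_append set_rev list.set) blast
    finally show "{0..<N + 1} \<subseteq> set ?P \<union> set ?c" .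
    have "{1..<N + 1} \<subseteq> {N - 4 * g + 1..<N - 2 * g - 2 * K} \<union> {N - 2 * g + 1..N} \<union>
      {N - 6 * g + 2 * K + 1..N - 4 * g - 1} \<union> {1..N - 6 * g + 2 * K - 2} \<union> {N - 2 * g - 2 * K + 1..N - 2 * g - 1} \<union>
      {N - 2 * g - 2 * K, N - 2 * g, N - 6 * g + 2 * K - 1, N - 4 * g, 2 * g - K}"
      using N_def unfolding interval_cover by (smt (verit))
    also have "\<dots> \<subseteq> diffs ?P \<union> diffs (?c @ [hd ?c])" (is "_ \<subseteq> ?S")
    proof -
      have "diffs B \<union> diffs p1 \<union> diffs t1 \<union> diffs t2 \<union> diffs Z \<subseteq> ?S"
        using B(7) p1(5) t1(5) t2(4) Z(5) by (auto simp: diffs_append)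
      \<comment> \<open>In order: the links from \<open>B\<close> to \<open>p1\<close>,
        \<open>p1\<close> to \<open>t1\<close> and \<open>t1\<close> to \<open>t2\<close>, then the
        two cycle edges at \<open>3 * g - K\<close>.\<close>
      moreover have "{N - 2 * g - 2 * K, N - 2 * g, N - 6 * g + 2 * K - 1, N - 4 * g, 2 * g - K} \<subseteq> ?S"
        using B(5,7) p1(3-5) t1(3-5) t2(3,4) Z(3-5) K g by (simp add: diffs_append hd_rev last_rev N_def)
      ultimately show ?thesis using B(4) p1(2) t1(2) t2(2) Z(2) by blast
    qed
    finally show "{1..<N + 1} \<subseteq> diffs ?P \<union> diffs (?c @ [hd ?c])" .
  qed (use B in auto)
  moreover have "length ?c = 2 * k + 1" by (simp add: Z_def K_def)
  moreover have "hd ?P = N - (2 * g - K)" using B by (simp add: hd_rev)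
  ultimately have "graceful_from {#2 * k + 1#} N (N - (2 * g - K))"
    by (auto simp: graceful_from_def)
  from graceful_from_reflect[OF this] show ?thesis by (simp add: N_def)
qed

text \<open>The variant of opposite parity: \<open>p1\<close> has \<open>2 * g\<close> vertices and
  ends at the low label \<open>g - 1\<close>, so \<open>B\<close> is entered from its high side. The
  low edge has difference \<open>2 * g - 2 - K = N - 6 * g + 2 * K + 5\<close>.\<close>

lemma odd_base0:
  fixes k :: nat
  defines "K \<equiv> int k"
  assumes k: "k \<ge> 1" and g: "g \<ge> 2 * K + 2"
  shows "graceful_from {#2 * k + 1#} (8 * g - 7 - 3 * K) (2 * g - 2 - K)"
proof -
  define N where "N = 8 * g - 7 - 3 * K"
  have K: "K \<ge> 1" using k by (simp add: K_def)
  obtain B where B: "int (length B) = 2 * (g - 1 - K)" "{g + K..<2 * g - 1} \<subseteq> set B"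
    "{N - 2 * g + 2..<N - g - K + 1} \<subseteq> set B" "{N - 4 * g + 4..<N - 2 * g - 2 * K + 2 - 1} \<subseteq> diffs B"
    "hd B = N - g - 2 * K" "last B = 2 * g - 2 - K" "B \<noteq> []"
    by (rule placed_path_high[of K "g - 1 - K" "g + K" "N - 3 * g + K + 3"]) (use K g in \<open>auto simp: N_def algebra_simps\<close>)
  define p1 where "p1 = zag N 0 (2 * g)"
  define t1 where "t1 = zig (2 * g - 1) (N - 2 * g + 1) (2 * (g - 1 - K))"
  define t2 where "t2 = zig (3 * g - 1 - K) (N - 3 * g + 2 + K) (2 * g - 3 - K)"
  define Z where "Z = zig g (N - g) (2 * K)"
  have p1: "{N - g<..N} \<union> {0..<g} \<subseteq> set p1" "{N - 2 * g + 2..N} \<subseteq> diffs p1" "hd p1 = N" "last p1 = g - 1" "p1 \<noteq> []"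
    using set_zag_even[of N g 0] diffs_zag[of "2 * g" N 0] K g
    by (auto simp: p1_def N_def last_zag)
  have t1: "{2 * g - 1..<3 * g - 2 - K} \<union> {N - 3 * g + K + 2<..N - 2 * g + 1} \<subseteq> set t1"
    "{N - 6 * g + 2 * K + 6..N - 4 * g + 2} \<subseteq> diffs t1" "hd t1 = 2 * g - 1" "last t1 = N - 3 * g + K + 3" "t1 \<noteq> []"
    using set_zig_even[of "2 * g - 1" "g - 1 - K" "N - 2 * g + 1"]
      diffs_zig[of "2 * (g - 1 - K)" "N - 2 * g + 1" "2 * g - 1"] K g
    by (auto simp: t1_def N_def last_zig)
  have t2: "{3 * g - 1 - K..N - 3 * g + 2 + K} \<subseteq> set t2" "{1..N - 6 * g + 2 * K + 3} \<subseteq> diffs t2"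
    "hd t2 = 3 * g - 1 - K" "t2 \<noteq> []"
    using set_zig_full[of "2 * g - 3 - K" "N - 3 * g + 2 + K" "3 * g - 1 - K"]
      diffs_zig[of "2 * g - 3 - K" "N - 3 * g + 2 + K" "3 * g - 1 - K"] K g
    by (auto simp: t2_def N_def)
  have Z: "{g..<g + K} \<union> {N - g - K<..N - g} \<subseteq> set Z" "{N - 2 * g - 2 * K + 2..N - 2 * g} \<subseteq> diffs Z"
    "hd Z = g" "last Z = N - g - K + 1" "Z \<noteq> []"
    using set_zig_even[of g K "N - g"] diffs_zig[of "2 * K" "N - g" g] K g
    by (auto simp: Z_def N_def last_zig)
  let ?P = "rev B @ rev p1 @ t1 @ t2" and ?c = "Z @ [3 * g - 2 - K]"
  have "labelled {#length ?c#} (N + 1) ?P [?c]"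
  proof (rule labelled_single)
    have "int (length t2) = 2 * g - 3 - K" "int (length t1) = 2 * (g - 1 - K)" "int (length p1) = 2 * g"
      "int (length Z) = 2 * K"
      using K g by (simp_all add: t1_def t2_def p1_def Z_def)
    then show "int (length ?P) + int (length ?c) = N + 1"
      using B(1) by (simp add: N_def)
    have "{0..<N + 1} \<subseteq> {g + K..<2 * g - 1} \<union> {N - 2 * g + 2..<N - g - K + 1} \<union> ({N - g<..N} \<union> {0..<g}) \<union>
      ({2 * g - 1..<3 * g - 2 - K} \<union> {N - 3 * g + K + 2<..N - 2 * g + 1}) \<union> {3 * g - 1 - K..N - 3 * g + 2 + K} \<union>
      ({g..<g + K} \<union> {N - g - K<..N - g}) \<union> {3 * g - 2 - K}"
      unfolding interval_cover by (smt (verit))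
    also have "\<dots> \<subseteq> set ?P \<union> set ?c"
      using B(2,3) p1(1) t1(1) t2(1) Z(1) by (simp only: set_append set_rev list.set) blast
    finally show "{0..<N + 1} \<subseteq> set ?P \<union> set ?c" .
    have "{1..<N + 1} \<subseteq> {N - 4 * g + 4..<N - 2 * g - 2 * K + 2 - 1} \<union> {N - 2 * g + 2..N} \<union>
      {N - 6 * g + 2 * K + 6..N - 4 * g + 2} \<union> {1..N - 6 * g + 2 * K + 3} \<union> {N - 2 * g - 2 * K + 2..N - 2 * g} \<union>
      {N - 2 * g - 2 * K + 1, N - 2 * g + 1, N - 6 * g + 2 * K + 4, N - 4 * g + 3, 2 * g - 2 - K}"
      using N_def unfolding interval_cover by (smt (verit))
    also have "\<dots> \<subseteq> diffs ?P \<union> diffs (?c @ [hd ?c])" (is "_ \<subseteq> ?S")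
    proof -
      have "diffs B \<union> diffs p1 \<union> diffs t1 \<union> diffs t2 \<union> diffs Z \<subseteq> ?S"
        using B(7) p1(5) t1(5) t2(4) Z(5) by (auto simp: diffs_append)
      moreover have "{N - 2 * g - 2 * K + 1, N - 2 * g + 1, N - 6 * g + 2 * K + 4, N - 4 * g + 3, 2 * g - 2 - K} \<subseteq> ?S"
        using B(5,7) p1(3-5) t1(3-5) t2(3,4) Z(3-5) K g by (simp add: diffs_append hd_rev last_rev N_def)
      ultimately show ?thesis using B(4) p1(2) t1(2) t2(2) Z(2) by blast
    qed
    finally show "{1..<N + 1} \<subseteq> diffs ?P \<union> diffs (?c @ [hd ?c])" .
  qed (use B in auto)
  moreover have "length ?c = 2 * k + 1" by (simp add: Z_def K_def)
  moreover have "hd ?P = 2 * g - 2 - K" using B by (simp add: hd_rev)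
  ultimately have "graceful_from {#2 * k + 1#} N (2 * g - 2 - K)"
    by (auto simp: graceful_from_def)
  then show ?thesis by (simp add: N_def)
qed

text \<open>
  The new cycle consists of the zigzag \<open>Z\<close> and the label \<open>u\<close> skipped between the strips \<open>s1\<close> and \<open>s2\<close>;
  its edge from the last vertex of \<open>Z\<close> to \<open>u\<close> has difference \<open>D + 1\<close>. The number of labels per half is
  forced by the requirement that \<open>s2\<close> can be linked to the inner path.
\<close>

lemma odd_layer:
  fixes k :: nat
  defines "K \<equiv> int k"
  assumes G: "graceful_from M (2 * u + K - 3) r" and k: "k \<ge> 1" and r: "r \<ge> 0" and u: "u \<ge> r + 2 * K + 2"
    and e: "e = 0 \<or> e = 1"
  shows "graceful_from (add_mset (2 * k + 1) M) (10 * u + K - 8 - 2 * r + e) (4 * u - 4 + e - K - r)"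
proof -
  \<comment> \<open>\<open>D + 1 = 2 * u + K - 2\<close> is the difference between \<open>u\<close>
    and the last vertex \<open>3 * u - 2 + K\<close> of \<open>Z\<close>.\<close>
  define D where "D = 2 * u + K - 3"
  define N where "N = 10 * u + K - 8 - 2 * r + e"
  have K: "K \<ge> 1" using k by (simp add: K_def)
  \<comment> \<open>\<open>s2\<close> has \<open>2 * u - 3 + e\<close> vertices, so it ends on the
    low side for \<open>e = 0\<close> and on the high side for \<open>e = 1\<close>. Starting the
    inner path at \<open>D - r\<close> or at \<open>r\<close> accordingly gives the link difference
    \<open>N - 6 * u + 4 - e\<close> in both cases.\<close>
  obtain P cs where P: "labelled M (D + 1) P cs" "hd P = (if e = 0 then D - r else r)"
    using G graceful_from_reflect[OF G] e by (cases "e = 0") (auto simp: graceful_from_def D_def)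
  then have ne: "P \<noteq> []" "[] \<notin> set cs" by (auto simp: labelled_def)
  obtain B where B: "int (length B) = 2 * (u - 1 - K - r)" "{3 * u - 1 + K..<4 * u - 2 - r} \<subseteq> set B"
    "{N - 4 * u + 4 - e + r..<N - 3 * u + 3 - e - K} \<subseteq> set B"
    "{D + 2..<N - 6 * u + 4 - e - 2 * K} \<subseteq> diffs B"
    "hd B = 3 * u - 1 + 2 * K" "last B = N - (4 * u - 4 + e - K - r)" "B \<noteq> []"
    by (rule placed_path_low[of K "u - 1 - K - r" "3 * u - 1 + K" "N - 5 * u + 5 - e + K + 2 * r"])
      (use K u r e in \<open>auto simp: N_def D_def algebra_simps\<close>)
  define p1 where "p1 = zig (2 * u) (N - 2 * u + 1 - e) (2 * (u - 1))"
  define s1 where "s1 = zag N 0 (2 * u + 1)"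
  define s2 where "s2 = zig (u + 1) (N - u - 1) (2 * u - 3 + e)"
  define Z where "Z = zag (N - 3 * u + 2 - e) (3 * u - 1) (2 * K)"
  \<comment> \<open>The new layer has the \<open>p\<close> low labels \<open>0, ..., p - 1\<close>;
    the inner labelling moves to \<open>p, ..., p + D\<close>.\<close>
  define p where "p = 4 * u - 2 - r"
  let ?f = "\<lambda>x. x + p"
  have p1: "{2 * u..<3 * u - 1} \<union> {N - 3 * u + 2 - e<..N - 2 * u + 1 - e} \<subseteq> set p1"
    "{N - 6 * u + 5 - e..N - 4 * u + 1 - e} \<subseteq> diffs p1" "hd p1 = 2 * u" "last p1 = N - 3 * u + 3 - e" "p1 \<noteq> []"
    using set_zig_even[of "2 * u" "u - 1" "N - 2 * u + 1 - e"]
      diffs_zig[of "2 * (u - 1)" "N - 2 * u + 1 - e" "2 * u"] K u r e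
    by (auto simp: p1_def N_def last_zig)
  have s1: "{N - u..N} \<union> {0..<u} \<subseteq> set s1" "{N - 2 * u + 1..N} \<subseteq> diffs s1" "hd s1 = N" "last s1 = N - u" "s1 \<noteq> []"
  proof -
    have "N \<ge> 2 * u" using K u r e by (auto simp: N_def)
    then show "{N - u..N} \<union> {0..<u} \<subseteq> set s1" "{N - 2 * u + 1..N} \<subseteq> diffs s1"
      "hd s1 = N" "last s1 = N - u" "s1 \<noteq> []"
      using set_zag_odd[of N u 0] diffs_zag[of "2 * u + 1" N 0] K u r
      by (auto simp: s1_def last_zag algebra_simps)
  qed
  have s2: "{u + 1..<2 * u} \<union> {N - 2 * u + 1 - e<..N - u - 1} \<subseteq> set s2"
    "{N - 4 * u + 3 - e..N - 2 * u - 2} \<subseteq> diffs s2" "hd s2 = u + 1"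
    "last s2 = (if e = 0 then 2 * u - 1 else N - 2 * u + 1)" "s2 \<noteq> []"
  proof -
    have N: "N \<ge> 4 * u" using K u r e by (auto simp: N_def)
    show "{u + 1..<2 * u} \<union> {N - 2 * u + 1 - e<..N - u - 1} \<subseteq> set s2"
    proof (cases "e = 0")
      case True
      have "{u + 1..<2 * u} \<union> {N - 2 * u + 1 - e<..N - u - 1} =
        {u + 1..u + 1 + (u - 2)} \<union> {N - u - 1 - (u - 2)<..N - u - 1}"
        using True by auto
      moreover have "s2 = zig (u + 1) (N - u - 1) (2 * (u - 2) + 1)"
        using True by (simp add: s2_def algebra_simps)
      ultimately show ?thesis using set_zig_odd by metis
    next
      case False
      then have "e = 1" using e by simp
      then have "{u + 1..<2 * u} \<union> {N - 2 * u + 1 - e<..N - u - 1} =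
        {u + 1..<u + 1 + (u - 1)} \<union> {N - u - 1 - (u - 1)<..N - u - 1}"
        by auto
      moreover have "s2 = zig (u + 1) (N - u - 1) (2 * (u - 1))"
        using \<open>e = 1\<close> by (simp add: s2_def algebra_simps)
      ultimately show ?thesis using set_zig_even by metis
    qed
    have "{N - u - 1 - (u + 1) - (2 * u - 3 + e) + 2..N - u - 1 - (u + 1)} \<subseteq> diffs s2"
      unfolding s2_def by (rule diffs_zig) (use N e in auto)
    then show "{N - 4 * u + 3 - e..N - 2 * u - 2} \<subseteq> diffs s2" by (simp add: algebra_simps)
    show "last s2 = (if e = 0 then 2 * u - 1 else N - 2 * u + 1)"
      using e K u r by (auto simp: s2_def last_zig)
  qed (use e K u r in \<open>auto simp: s2_def\<close>)
  have Z: "{3 * u - 1..<3 * u - 1 + K} \<union> {N - 3 * u + 2 - e - K<..N - 3 * u + 2 - e} \<subseteq> set Z"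
    "{N - 6 * u + 5 - e - 2 * K..N - 6 * u + 3 - e} \<subseteq> diffs Z"
    "hd Z = N - 3 * u + 2 - e" "last Z = 3 * u - 2 + K" "Z \<noteq> []"
    using set_zag_even[of "N - 3 * u + 2 - e" K "3 * u - 1"]
      diffs_zag[of "2 * K" "N - 3 * u + 2 - e" "3 * u - 1"] K u r e
    by (auto simp: Z_def N_def last_zag)
  let ?X = "rev B @ rev p1 @ s1 @ s2" and ?c = "u # Z"
  have "labelled (add_mset (2 * k + 1) M) (N + 1) (?X @ map ?f P) ([?c] @ map (map ?f) cs)"
    unfolding labelled_def
  proof (intro conjI)
    have "int (length s2) = 2 * u - 3 + e" "int (length s1) = 2 * u + 1" "int (length p1) = 2 * (u - 1)"
      using K u r e by (auto simp: s1_def s2_def p1_def)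
    moreover have "int (length P) + int (sum_mset M) = D + 1" using P by (simp add: labelled_def)
    ultimately show "int (length (?X @ map ?f P)) + int (sum_mset (add_mset (2 * k + 1) M)) = N + 1"
      using B(1) by (simp add: N_def D_def K_def)
    have "length Z = 2 * k" by (simp add: Z_def K_def nat_mult_distrib)
    then show "mset (map length ([?c] @ map (map ?f) cs)) = add_mset (2 * k + 1) M"
      using P by (simp add: labelled_def)
    have V: "labels (?X @ map ?f P) ([?c] @ map (map ?f) cs) = labels ?X [?c] \<union> ?f ` labels P cs"
      by (simp only: labels_append labels_map)
    have "x \<in> ?f ` labels P cs" if "x \<in> {p..<p + D + 1}" for x
    proof -
      have "x - p \<in> labels P cs" using P that by (auto simp: labelled_def)
      then show ?thesis by (rule rev_image_eqI) simp
    qed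
    then have I: "{p..<p + D + 1} \<subseteq> ?f ` labels P cs" by blast
    have "{0..<N + 1} \<subseteq> {3 * u - 1 + K..<4 * u - 2 - r} \<union> {N - 4 * u + 4 - e + r..<N - 3 * u + 3 - e - K} \<union>
      ({2 * u..<3 * u - 1} \<union> {N - 3 * u + 2 - e<..N - 2 * u + 1 - e}) \<union> ({N - u..N} \<union> {0..<u}) \<union>
      ({u + 1..<2 * u} \<union> {N - 2 * u + 1 - e<..N - u - 1}) \<union>
      ({3 * u - 1..<3 * u - 1 + K} \<union> {N - 3 * u + 2 - e - K<..N - 3 * u + 2 - e}) \<union> {u} \<union> {p..<p + D + 1}"
      using N_def D_def p_def unfolding interval_cover by (smt (verit))
    also have "\<dots> \<subseteq> labels ?X [?c] \<union> ?f ` labels P cs"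
    proof -
      have "set B \<union> set p1 \<union> set s1 \<union> set s2 \<union> set Z \<union> {u} \<subseteq> labels ?X [?c]"
        by (auto simp: labels_def)
      with B(2,3) p1(1) s1(1) s2(1) Z(1) have "{3 * u - 1 + K..<4 * u - 2 - r} \<union>
        {N - 4 * u + 4 - e + r..<N - 3 * u + 3 - e - K} \<union>
        ({2 * u..<3 * u - 1} \<union> {N - 3 * u + 2 - e<..N - 2 * u + 1 - e}) \<union> ({N - u..N} \<union> {0..<u}) \<union>
        ({u + 1..<2 * u} \<union> {N - 2 * u + 1 - e<..N - u - 1}) \<union>
        ({3 * u - 1..<3 * u - 1 + K} \<union> {N - 3 * u + 2 - e - K<..N - 3 * u + 2 - e}) \<union> {u} \<subseteq> labels ?X [?c]"
        by blast
      then show ?thesis using I by (rule Un_mono)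
    qed
    finally show "{0..<N + 1} \<subseteq> labels (?X @ map ?f P) ([?c] @ map (map ?f) cs)"
      unfolding V .
    have "differences (map ?f P) (map (map ?f) cs) = differences P cs"
      using ne by (intro differences_map) auto
    then have E: "differences (?X @ map ?f P) ([?c] @ map (map ?f) cs) =
      insert \<bar>last ?X - hd (map ?f P)\<bar> (differences ?X [?c] \<union> differences P cs)"
      using ne B by (subst differences_append) auto
    have "{1..<N + 1} \<subseteq> {1..<D + 1} \<union> ({D + 2..<N - 6 * u + 4 - e - 2 * K} \<union> {N - 6 * u + 5 - e..N - 4 * u + 1 - e} \<union>
      {N - 2 * u + 1..N} \<union> {N - 4 * u + 3 - e..N - 2 * u - 2} \<union> {N - 6 * u + 5 - e - 2 * K..N - 6 * u + 3 - e} \<union>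
      {D + 1, N - 2 * u, N - 2 * u - 1, N - 4 * u + 2 - e, N - 6 * u + 4 - e - 2 * K}) \<union> {N - 6 * u + 4 - e}"
      using N_def D_def unfolding interval_cover by (smt (verit))
    also have "\<dots> \<subseteq> differences P cs \<union> differences ?X [?c] \<union> {\<bar>last ?X - hd (map ?f P)\<bar>}"
    proof (intro Un_mono)
      show "{1..<D + 1} \<subseteq> differences P cs" using P by (simp add: labelled_def)
      show "{N - 6 * u + 4 - e} \<subseteq> {\<bar>last ?X - hd (map ?f P)\<bar>}"
        using s2(4,5) P ne u K r e by (auto simp: hd_map N_def D_def p_def)
      have "diffs B \<union> diffs p1 \<union> diffs s1 \<union> diffs s2 \<union> diffs Z \<subseteq> differences ?X [?c]"
        using B(7) p1(5) s1(5) s2(5) Z(5) diffs_append[of "u # Z" "[u]"]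
        by (cases Z) (auto simp: differences_def diffs_append)
      \<comment> \<open>In order: the low edge from \<open>u\<close> to the end of \<open>Z\<close>,
        the links from \<open>p1\<close> to \<open>s1\<close> and \<open>s1\<close> to
        \<open>s2\<close>, the edge from \<open>u\<close> to the start of \<open>Z\<close>, and the
        link from \<open>B\<close> to \<open>p1\<close>.\<close>
      moreover have "{D + 1, N - 2 * u, N - 2 * u - 1, N - 4 * u + 2 - e, N - 6 * u + 4 - e - 2 * K} \<subseteq> differences ?X [?c]"
        using B(5,7) p1(3-5) s1(3-5) s2(3,5) Z(3-5) K u r e diffs_append[of "u # Z" "[u]"] diffs_append[of "[u]" Z]
        by (auto simp: differences_def diffs_append hd_rev last_rev N_def D_def)
      ultimately show "{D + 2..<N - 6 * u + 4 - e - 2 * K} \<union> {N - 6 * u + 5 - e..N - 4 * u + 1 - e} \<union>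
        {N - 2 * u + 1..N} \<union> {N - 4 * u + 3 - e..N - 2 * u - 2} \<union> {N - 6 * u + 5 - e - 2 * K..N - 6 * u + 3 - e} \<union>
        {D + 1, N - 2 * u, N - 2 * u - 1, N - 4 * u + 2 - e, N - 6 * u + 4 - e - 2 * K} \<subseteq> differences ?X [?c]"
        using B(4) p1(2) s1(2) s2(2) Z(2) by blast
    qed
    finally show "{1..<N + 1} \<subseteq> differences (?X @ map ?f P) ([?c] @ map (map ?f) cs)"
      unfolding E by auto
  qed (use ne B in auto)
  moreover have "hd (?X @ map ?f P) = N - (4 * u - 4 + e - K - r)" using B by (simp add: hd_rev)
  ultimately have "graceful_from (add_mset (2 * k + 1) M) N (N - (4 * u - 4 + e - K - r))"
    unfolding graceful_from_def by blast
  from graceful_from_reflect[OF this] show ?thesis by (simp add: N_def algebra_simps)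
qed

text \<open>The layer expressed through \<open>D\<close>, with \<open>2 * u = D + 3 - k\<close>;
  hence \<open>D\<close> and \<open>k\<close> must have opposite parity.\<close>

lemma odd_layer_diff:
  fixes k :: nat
  assumes "graceful_from M D r" "k \<ge> 1" "r \<ge> 0" "D \<ge> 2 * r + 5 * int k + 1" "even D \<longleftrightarrow> odd k" "e = 0 \<or> e = 1"
  shows "graceful_from (add_mset (2 * k + 1) M) (5 * D - 4 * int k + 7 - 2 * r + e) (2 * D + 2 - 3 * int k - r + e)"
proof -
  have "even (D + 3 - int k)" using assms(5) by auto
  then obtain u where u: "D + 3 - int k = 2 * u" by (elim evenE)
  then have D: "D = 2 * u + int k - 3" by simp
  then have "graceful_from (add_mset (2 * k + 1) M) (10 * u + int k - 8 - 2 * r + e) (4 * u - 4 + e - int k - r)"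
    using assms by (intro odd_layer) auto
  then show ?thesis by (simp add: D algebra_simps)
qed

text \<open>
  The free parameter \<open>t\<close> makes the start label as large as the even cycles require.
\<close>

lemma odd_chain:
  fixes K :: nat
  assumes K: "K \<ge> 1" and M: "\<And>l. l \<in># M \<Longrightarrow> odd l \<and> 3 \<le> l \<and> l \<le> 2 * K + 1"
  shows "\<exists>D R A B. (\<forall>t\<ge>0. graceful_from (add_mset (2 * K + 1) M) (D + t * A) (R + t * B)) \<and>
    even A \<and> even B \<and> (even D \<longleftrightarrow> b) \<and> 2 \<le> B \<and> 2 * B \<le> A \<and> A \<le> 4 * B \<and>
    2 * R + 5 * int K + 1 \<le> D \<and> D \<le> 4 * R + int K + 1 \<and> 3 * int K \<le> R \<and>
    D + 4 * R \<le> 7 ^ size M * (25 * int K + 17) \<and> B \<le> 2 * 7 ^ size M"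
  using M
proof (induction M arbitrary: b)
  case empty
  show ?case
  \<comment> \<open>The two base cases at their least \<open>g\<close> plus \<open>t\<close>, so
    \<open>A = 8\<close> and \<open>B = 2\<close>. Their values of \<open>D\<close> differ by one,
    which serves both parities and gives the constant \<open>25 * K + 17\<close> for
    \<open>D + 4 * R\<close>.\<close>
  proof (cases "even K = b")
    case True
    have "graceful_from {#2 * K + 1#} (13 * int K + 8 + t * 8) (3 * int K + 2 + t * 2)" if "t \<ge> 0" for t
      using odd_base1[of K "2 * int K + 1 + t"] K that by (simp add: algebra_simps)
    then show ?thesis
      using True K by (intro exI[of _ "13 * int K + 8"] exI[of _ "3 * int K + 2"] exI[of _ 8] exI[of _ 2]) auto
  next
    case False
    have "graceful_from {#2 * K + 1#} (13 * int K + 9 + t * 8) (3 * int K + 2 + t * 2)" if "t \<ge> 0" for t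
      using odd_base0[of K "2 * int K + 2 + t"] K that by (simp add: algebra_simps)
    then show ?thesis
      using False K by (intro exI[of _ "13 * int K + 9"] exI[of _ "3 * int K + 2"] exI[of _ 8] exI[of _ 2]) auto
  qed
next
  case (add l M)
  obtain k where l: "l = 2 * k + 1" and k: "1 \<le> k" "k \<le> K"
    using add.prems[of l] by (auto elim!: oddE)
  \<comment> \<open>The induction hypothesis is used with the parity of \<open>D\<close> that the
    layer for \<open>k\<close> requires.\<close>
  obtain D R A B where G: "\<And>t. t \<ge> 0 \<Longrightarrow> graceful_from (add_mset (2 * K + 1) M) (D + t * A) (R + t * B)"
    and par: "even A" "even B" "even D \<longleftrightarrow> odd k"
    and AB: "2 \<le> B" "2 * B \<le> A" "A \<le> 4 * B"
    and DR: "2 * R + 5 * int K + 1 \<le> D" "D \<le> 4 * R + int K + 1" "3 * int K \<le> R"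
    and S: "D + 4 * R \<le> 7 ^ size M * (25 * int K + 17)" "B \<le> 2 * 7 ^ size M"
    using add.IH[of "odd k"] add.prems by auto
  \<comment> \<open>\<open>D'\<close> has the parity of \<open>D + 1 + e\<close>, so
    \<open>e\<close> adjusts it to \<open>b\<close>.\<close>
  define e :: int where "e = (if even (D + 1) = b then 0 else 1)"
  have e: "e = 0 \<or> e = 1" by (simp add: e_def)
  define D' where "D' = 5 * D - 4 * int k + 7 - 2 * R + e"
  define R' where "R' = 2 * D + 2 - 3 * int k - R + e"
  have "graceful_from (add_mset l (add_mset (2 * K + 1) M)) (D' + t * (5 * A - 2 * B)) (R' + t * (2 * A - B))"
    if t: "t \<ge> 0" for t
  proof -
    have "t * (2 * B) \<le> t * A" using t AB by (intro mult_left_mono) auto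
    moreover have "0 \<le> t * B" using t AB by auto
    ultimately have "graceful_from (add_mset l (add_mset (2 * K + 1) M))
      (5 * (D + t * A) - 4 * int k + 7 - 2 * (R + t * B) + e) (2 * (D + t * A) + 2 - 3 * int k - (R + t * B) + e)"
      unfolding l using G[OF t] k DR par e by (intro odd_layer_diff) auto
    then show ?thesis by (simp add: D'_def R'_def algebra_simps)
  qed
  then have 1: "\<forall>t\<ge>0. graceful_from (add_mset (2 * K + 1) (add_mset l M)) (D' + t * (5 * A - 2 * B)) (R' + t * (2 * A - B))"
    by (simp add: add_mset_commute)
  have 2: "even D' \<longleftrightarrow> b" by (auto simp: D'_def e_def)
  have le: "0 \<le> e" "e \<le> 1" "1 \<le> int k" "int k \<le> int K" using e k by auto
  have 3: "2 * R' + 5 * int K + 1 \<le> D'" "D' \<le> 4 * R' + int K + 1" "3 * int K \<le> R'"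
    using DR le unfolding D'_def R'_def by (smt (verit))+
  \<comment> \<open>The source of the powers of 7: \<open>D + 4 * R\<close> grows at most by this
    factor, as \<open>D \<le> 4 * R + K + 1\<close> and \<open>3 * K \<le> R\<close> absorb the
    other terms.\<close>
  have "D' + 4 * R' \<le> 7 * (D + 4 * R)" using DR le unfolding D'_def R'_def by (smt (verit))
  then have 4: "D' + 4 * R' \<le> 7 ^ size (add_mset l M) * (25 * int K + 17)" using S(1) by simp
  have 5: "2 * A - B \<le> 2 * 7 ^ size (add_mset l M)" using S(2) AB by simp
  have 6: "even (5 * A - 2 * B)" "even (2 * A - B)" "2 \<le> 2 * A - B" "2 * (2 * A - B) \<le> 5 * A - 2 * B"
    "5 * A - 2 * B \<le> 4 * (2 * A - B)"
    using par AB by simp_all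
  show ?case
    by (rule exI[of _ D'], rule exI[of _ R'], rule exI[of _ "5 * A - 2 * B"], rule exI[of _ "2 * A - B"])
      (intro conjI 1 2 3 4 5 6)
qed

text \<open>The odd cycles form an inner labelling with \<open>D + t * A\<close> edges and start
  \<open>R + t * B\<close>; a block with the even cycles and all remaining path vertices is wrapped
  around it. The start must be large enough for the even cycles and the remaining size large enough
  for that start.\<close>

lemma graceful_from_exists:
  fixes M :: "nat multiset" and N X Y :: int
  defines "Me \<equiv> filter_mset even M" and "Mo \<equiv> filter_mset odd M"
  assumes M: "\<And>l. l \<in># M \<Longrightarrow> l \<ge> 3"
    and N: "N \<ge> X + Y + 9" "X \<ge> 21" "Y \<ge> 6"
    and X: "\<And>l. l \<in># Mo \<Longrightarrow> 7 ^ size Mo * (2 * int l + 1) \<le> X"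
    and Y: "\<And>l. l \<in># Me \<Longrightarrow> 12 * int (size Me) * (int l + 3) - 6 \<le> Y"
  shows "\<exists>r. graceful_from M N r"
proof -
  have split: "M = Me + Mo" unfolding Me_def Mo_def by simp
  \<comment> \<open>With or without even cycles, every start \<open>R \<ge> R0\<close> and every
    size from \<open>4 * R + r\<close> on is available. The bound on \<open>8 * R0 + r\<close> is
    used when \<open>t\<close> is chosen.\<close>
  have even_part: "\<exists>R0 r. r \<ge> 0 \<and> R0 \<ge> 0 \<and> (\<forall>R\<ge>R0. \<forall>n\<ge>4 * R + r. alpha_block Me n R) \<and>
      8 * R0 + r + 10 \<le> Y + 9 \<and> 4 * R0 + r \<le> Y \<and> r \<le> Y + 6"
  proof (cases "Me = {#}")
    case True
    have p: "alpha_block Me n R" if "R \<ge> 0" "n \<ge> 4 * R + 2" for n R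
      unfolding True by (rule alpha_block_path) (use that in auto)
    show ?thesis
      by (rule exI[of _ 0], rule exI[of _ 2]) (use N p in auto)
  next
    case False
    define L where "L = Max (set_mset Me)"
    have "L \<in># Me" unfolding L_def using False by (intro Max_in) auto
    have L: "\<And>l. l \<in># Me \<Longrightarrow> l \<le> L" by (simp add: L_def)
    have "even L" "L \<ge> 4" using \<open>L \<in># Me\<close> M[of L] by (auto simp: Me_def elim!: evenE)
    define i where "i = int (size Me)"
    have "i \<ge> 1" using False by (cases Me) (auto simp: i_def)
    \<comment> \<open>The least \<open>r\<close> with \<open>3 * L \<le> 4 * r\<close>, since
      \<open>3 * L\<close> is even.\<close>
    define r where "r = (3 * int L + 2) div 4"
    have r: "3 * int L \<le> 4 * r" "4 * r \<le> 3 * int L + 2"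
      using \<open>even L\<close> by (auto simp: r_def elim!: evenE)
    define R0 where "R0 = (i * (4 * r + int L + 8) + 3) div 4"
    have R0: "i * (4 * r + int L + 8) \<le> 4 * R0" "4 * R0 \<le> i * (4 * r + int L + 8) + 3"
      unfolding R0_def by linarith+
    have ev: "even l \<and> 4 \<le> l \<and> l \<le> L" if "l \<in># Me" for l
      using that L[OF that] M[of l] by (auto simp: Me_def elim!: evenE)
    have "alpha_block Me n R" if "R \<ge> R0" "n \<ge> 4 * R + (2 * r + 5)" for n R
      by (rule alpha_block_evens[OF False ev r(1)]) (use that R0 in \<open>auto simp: i_def\<close>)
    moreover have "8 * R0 + (2 * r + 5) + 10 \<le> Y + 9 \<and> 4 * R0 + (2 * r + 5) \<le> Y \<and> 2 * r + 5 \<le> Y + 6"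
      and "R0 \<ge> 0" "2 * r + 5 \<ge> 0"
    proof -
      have "i * (4 * r + int L + 8) \<le> i * (4 * int L + 10)"
        using r \<open>i \<ge> 1\<close> by (intro mult_left_mono) auto
      moreover have "0 \<le> i * (4 * r + int L + 8)" using \<open>i \<ge> 1\<close> r by auto
      moreover define W where "W = i * int L"
      ultimately have "4 * R0 \<le> 4 * W + 10 * i + 3" "R0 \<ge> 0"
        using R0 by (simp_all add: algebra_simps)
      moreover have "int L \<le> W"
        using \<open>i \<ge> 1\<close> mult_right_mono[of 1 i "int L"] by (simp add: W_def)
      moreover have "12 * W + 36 * i - 6 \<le> Y"
        using Y[OF \<open>L \<in># Me\<close>] by (simp add: i_def W_def algebra_simps)
      ultimately show "8 * R0 + (2 * r + 5) + 10 \<le> Y + 9 \<and> 4 * R0 + (2 * r + 5) \<le> Y \<and> 2 * r + 5 \<le> Y + 6"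
        "R0 \<ge> 0" "2 * r + 5 \<ge> 0"
        using r \<open>i \<ge> 1\<close> \<open>L \<ge> 4\<close> by auto
    qed
    ultimately show ?thesis by blast
  qed
  then obtain R0 r where R0: "r \<ge> 0" "R0 \<ge> 0" "\<And>R n. R \<ge> R0 \<Longrightarrow> n \<ge> 4 * R + r \<Longrightarrow> alpha_block Me n R"
    and Y': "8 * R0 + r + 1 \<le> Y" "4 * R0 + r \<le> Y" "r \<le> Y + 6"
    by auto
  show ?thesis
  proof (cases "Mo = {#}")
    case True
    have "alpha_block M (N + 1) R0" using R0(3)[of R0 "N + 1"] N Y' True split by simp
    then show ?thesis using alpha_block_imp_graceful_from by fastforce
  next
    case False
    define l where "l = Max (set_mset Mo)"
    have "l \<in># Mo" unfolding l_def using False by (intro Max_in) auto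
    moreover have l: "\<And>j. j \<in># Mo \<Longrightarrow> j \<le> l" by (simp add: l_def)
    moreover from \<open>l \<in># Mo\<close> obtain K where K: "l = 2 * K + 1"
      by (auto simp: Mo_def elim!: oddE)
    ultimately obtain M' where M': "Mo = add_mset (2 * K + 1) M'"
      by (metis multi_member_split)
    have "K \<ge> 1" using M[of l] \<open>l \<in># Mo\<close> K by (simp add: Mo_def)
    have "odd j \<and> 3 \<le> j \<and> j \<le> 2 * K + 1" if "j \<in># M'" for j
    proof -
      have "j \<in># Mo" using that M' by simp
      then show ?thesis using l[of j] M[of j] K by (simp add: Mo_def)
    qed
    from odd_chain[OF \<open>K \<ge> 1\<close> this, of M' True]
    obtain D R A B where G: "\<And>t. t \<ge> 0 \<Longrightarrow> graceful_from Mo (D + t * A) (R + t * B)"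
      and AB: "2 \<le> B" "2 * B \<le> A" "A \<le> 4 * B"
      and DR: "2 * R + 5 * int K + 1 \<le> D" "D \<le> 4 * R + int K + 1" "3 * int K \<le> R"
      and S: "D + 4 * R \<le> 7 ^ size M' * (25 * int K + 17)" "B \<le> 2 * 7 ^ size M'"
      unfolding M' by blast
    define q :: int where "q = 7 ^ size M'"
    have q: "q \<ge> 1" by (simp add: q_def)
    have X': "28 * (q * int K) + 21 * q \<le> X"
      using X[OF \<open>l \<in># Mo\<close>] by (simp add: M' K q_def algebra_simps)
    have S': "D + 4 * R \<le> 25 * (q * int K) + 17 * q" "B \<le> 2 * q"
      using S by (auto simp: q_def algebra_simps)
    have qK: "int K \<le> q * int K" "1 \<le> q * int K" using q \<open>K \<ge> 1\<close> mult_mono[of 1 q 1 "int K"] by (auto simp: mult_le_cancel_right1)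
    have "\<exists>t\<ge>0. R + t * B \<ge> R0 \<and> N - (D + t * A) \<ge> 4 * (R + t * B) + r"
    proof (cases "R \<ge> R0")
      case True
      then show ?thesis using S' X' Y' N qK q by (intro exI[of _ 0]) auto
    next
      case False
      \<comment> \<open>The least \<open>t\<close> with \<open>R + t * B \<ge> R0\<close>; it
        overshoots by at most \<open>B - 1\<close>.\<close>
      define t where "t = (R0 - R + B - 1) div B"
      have "t \<ge> 0" using False AB by (simp add: t_def pos_imp_zdiv_nonneg_iff)
      have "t * B = R0 - R + B - 1 - (R0 - R + B - 1) mod B"
        by (simp add: t_def minus_mod_eq_div_mult)
      moreover have "0 \<le> (R0 - R + B - 1) mod B" "(R0 - R + B - 1) mod B < B" using AB by auto
      ultimately have tB: "R0 - R \<le> t * B" "t * B \<le> R0 - R + B - 1" by linarith+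
      \<comment> \<open>Hence \<open>D + t * A + 4 * (R + t * B) + r\<close> is at most
        \<open>D - 4 * R + 8 * (R0 + B - 1) + r\<close>, where
        \<open>D - 4 * R \<le> K + 1\<close>.\<close>
      have "t * A \<le> t * (4 * B)" using \<open>t \<ge> 0\<close> AB by (intro mult_left_mono) auto
      then show ?thesis
        using \<open>t \<ge> 0\<close> tB DR S' X' Y' N qK q by (intro exI[of _ t]) auto
    qed
    then obtain t where t: "t \<ge> 0" "R + t * B \<ge> R0" "N - (D + t * A) \<ge> 4 * (R + t * B) + r" by blast
    have "graceful_from (Me + Mo) (N - (D + t * A) + (D + t * A)) (R + t * B)"
      by (rule alpha_block_stack_graceful_from[OF R0(3) G]) (use t in auto)
    then show ?thesis using split by auto
  qed
qed

section \<open>Graphs\<close>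

text \<open>Serves to reorder the labelled cycles so that their lengths become
  \<open>l 1, ..., l s\<close>.\<close>

lemma image_mset_eq_msetE:
  assumes "image_mset f A = mset ys"
  obtains xs where "mset xs = A" "map f xs = ys"
  using assms
proof (induction ys arbitrary: A thesis)
  case Nil
  then show ?case by (intro Nil(1)[of "[]"]) auto
next
  case (Cons y ys)
  then have "y \<in># image_mset f A" by simp
  then obtain x where x: "x \<in># A" "y = f x" by auto
  then obtain A' where A: "A = add_mset x A'" by (metis multi_member_split)
  then have "image_mset f A' = mset ys" using Cons.prems x by simp
  then obtain xs where "mset xs = A'" "map f xs = ys" using Cons.IH by blast
  then show ?case using A x by (intro Cons.prems(1)[of "x # xs"]) auto
qed

lemma equiv_connected_rel: "equiv V (connected_rel V E)"
proof (rule equivI)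
  have "sym {(x, y). {x, y} \<in> E}" by (auto simp: sym_def insert_commute)
  then have "sym ({(x, y). {x, y} \<in> E}\<^sup>*)" by (rule sym_rtrancl)
  then show "sym (connected_rel V E)" by (auto simp: connected_rel_def sym_def)
qed (auto simp: connected_rel_def refl_on_def trans_def)

lemma edge_in_component:
  assumes "simple_graph V E" "e \<in> E"
  obtains W where "W \<in> components V E" "e \<in> induced_edges E W"
proof -
  obtain x y where e: "e = {x, y}" "x \<in> V" "y \<in> V"
    using assms by (fastforce simp: simple_graph_def card_2_iff)
  then have "(x, y) \<in> connected_rel V E" "(x, x) \<in> connected_rel V E"
    using assms(2) by (auto simp: connected_rel_def)
  then show ?thesis
    using e assms(2) by (intro that[of "connected_rel V E `` {x}"])
      (auto simp: components_def induced_edges_def quotientI)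
qed

text \<open>A set no larger than \<open>B\<close> whose image covers \<open>B\<close> has no room
  for repeated or further values. This turns the inclusions in \<open>labelled\<close> into
  bijections.\<close>

lemma inj_on_image_eq_if_card_le:
  assumes "finite A" "B \<subseteq> f ` A" "card A \<le> card B"
  shows "inj_on f A" "f ` A = B"
proof -
  have "card (f ` A) \<le> card A" using assms(1) by (rule card_image_le)
  moreover have "card B \<le> card (f ` A)" using assms by (intro card_mono) auto
  ultimately have "card (f ` A) = card A" "card (f ` A) = card B" using assms(3) by linarith+
  then show "inj_on f A" "f ` A = B"
    using assms card_subset_eq[of "f ` A" B] by (simp_all add: eq_card_imp_inj_on)
qed

text \<open>The lists are transported to the components along their parametrizations. The lists
  cover all labels and differences, so upper bounds for the numbers of vertices and edges give
  gracefulness.\<close>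

lemma graceful_of_graceful_from:
  assumes G: "cycles_and_path V E s l m"
    and labelled: "graceful_from (image_mset l (mset_set {1..s})) (int m + int (\<Sum>i=1..s. l i)) r"
  shows "\<exists>f. graceful_labeling V E f"
proof -
  let ?M = "image_mset l (mset_set {1..s})"
  define N where "N = m + (\<Sum>i=1..s. l i)"
  have sumM: "sum_mset ?M = (\<Sum>i=1..s. l i)" by (simp add: sum_unfold_sum_mset)
  obtain P cs0 where P: "labelled ?M (int N + 1) P cs0"
    using labelled by (auto simp: graceful_from_def N_def)
  then have "image_mset length (mset cs0) = ?M" by (simp add: labelled_def)
  also have "?M = mset (map l [1..<Suc s])"
  proof -
    have "mset_set {1..s} = mset [1..<Suc s]" by (simp only: mset_upt atLeastLessThanSuc_atLeastAtMost)
    then show ?thesis by simp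
  qed
  finally obtain cs where cs: "mset cs = mset cs0" "map length cs = map l [1..<Suc s]"
    by (rule image_mset_eq_msetE)
  define cyc where "cyc i = cs ! (i - 1)" for i
  have lencs: "length cs = s" using arg_cong[OF cs(2), of length] by simp
  have cyc: "length (cyc i) = l i" if "i \<in> {1..s}" for i
  proof -
    have "length (cyc i) = map length cs ! (i - 1)" using that lencs by (auto simp: cyc_def)
    also have "\<dots> = l i" 
      unfolding cs(2) using that nth_map_upt[of "i - 1" "Suc s" 1 l] by (auto simp del: upt_Suc)
    finally show ?thesis .
  qed
  have "cs ! j \<in> cyc ` {1..s}" if "j < s" for j
    using that by (intro image_eqI[of _ _ "Suc j"]) (auto simp: cyc_def)
  then have "set cs \<subseteq> cyc ` {1..s}"
    using lencs by (metis in_set_conv_nth subsetI)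
  then have set_cs: "set cs0 \<subseteq> cyc ` {1..s}" using mset_eq_setD[OF cs(1)] by simp
  have "int (length P) + int (\<Sum>i=1..s. l i) = int N + 1"
    using P unfolding labelled_def sumM by blast
  then have len: "length P = Suc m" unfolding N_def by linarith
  have Vcov: "{0..int N} \<subseteq> set P \<union> (\<Union>i\<in>{1..s}. set (cyc i))"
  proof -
    have "labels P cs0 \<subseteq> set P \<union> (\<Union>i\<in>{1..s}. set (cyc i))"
      unfolding labels_def using set_cs by blast
    moreover have "{0..int N} = {0..<int N + 1}" by auto
    ultimately show ?thesis using P unfolding labelled_def by blast
  qed
  have Ecov: "{1..int N} \<subseteq> diffs P \<union> (\<Union>i\<in>{1..s}. diffs (cyc i @ [hd (cyc i)]))"
  proof -
    have "differences P cs0 \<subseteq> diffs P \<union> (\<Union>i\<in>{1..s}. diffs (cyc i @ [hd (cyc i)]))"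
      unfolding differences_def using set_cs by blast
    moreover have "{1..int N} = {1..<int N + 1}" by auto
    ultimately show ?thesis using P unfolding labelled_def by blast
  qed

  from G obtain C where sg: "simple_graph V E"
    and C: "bij_betw C {0..s} (components V E)"
    and path: "is_path (C 0) (induced_edges E (C 0)) m"
    and cyc': "\<And>i. i \<in> {1..s} \<Longrightarrow> is_cycle (C i) (induced_edges E (C i)) (l i)"
    unfolding cycles_and_path_def by blast
  obtain p where p: "bij_betw p {..m} (C 0)" "induced_edges E (C 0) = {{p j, p (Suc j)} | j. j < m}"
    using path unfolding is_path_def by blast
  have "\<forall>i\<in>{1..s}. \<exists>c. bij_betw c {..<l i} (C i) \<and> induced_edges E (C i) = {{c j, c (Suc j mod l i)} | j. j < l i}"
    using cyc' unfolding is_cycle_def by blast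
  from bchoice[OF this] obtain c where c': "\<forall>i\<in>{1..s}. bij_betw (c i) {..<l i} (C i) \<and>
    induced_edges E (C i) = {{c i j, c i (Suc j mod l i)} | j. j < l i}" ..
  then have c: "\<And>i. i \<in> {1..s} \<Longrightarrow> bij_betw (c i) {..<l i} (C i)"
    "\<And>i. i \<in> {1..s} \<Longrightarrow> induced_edges E (C i) = {{c i j, c i (Suc j mod l i)} | j. j < l i}"
    by simp_all
  have l3: "l i \<ge> 3" if "i \<in> {1..s}" for i using cyc'[OF that] by (simp add: is_cycle_def)
  have comp: "components V E = C ` {0..s}" using C by (simp add: bij_betw_def)
  have disj: "i = j" if "v \<in> C i" "v \<in> C j" "i \<le> s" "j \<le> s" for i j v
  proof -
    have "C i \<in> V // connected_rel V E" "C j \<in> V // connected_rel V E"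
      using comp that by (auto simp: components_def)
    then have "C i = C j" using quotient_disj[OF equiv_connected_rel] that by blast
    then show ?thesis using C that by (auto simp: bij_betw_def inj_on_def)
  qed
  have Vsplit: "V = (\<Union>i\<in>{0..s}. C i)"
    using Union_quotient[OF equiv_connected_rel[of V E]] comp by (simp add: components_def)

  \<comment> \<open>The inverse of the parametrization gives the position of \<open>v\<close> in its
    component, and \<open>f\<close> reads the label there.\<close>
  define f where "f v = (if v \<in> C 0 then P ! the_inv_into {..m} p v
    else let i = THE i. i \<in> {1..s} \<and> v \<in> C i in cyc i ! the_inv_into {..<l i} (c i) v)" for v
  have fp: "f (p j) = P ! j" if "j \<le> m" for j
    using that p(1) by (auto simp: f_def bij_betw_def the_inv_into_f_f)
  have fc: "f (c i j) = cyc i ! j" if i: "i \<in> {1..s}" and j: "j < l i" for i j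
  proof -
    have mem: "c i j \<in> C i" using c(1)[OF i] j by (auto simp: bij_betw_def)
    then have "c i j \<notin> C 0" using disj[of "c i j" 0 i] i by auto
    moreover have "(THE i'. i' \<in> {1..s} \<and> c i j \<in> C i') = i"
      using mem i disj[of "c i j" _ i] by (intro the_equality) auto
    ultimately show ?thesis
      using c(1)[OF i] j by (simp add: f_def bij_betw_def the_inv_into_f_f)
  qed

  have finV: "finite V" using sg by (simp add: simple_graph_def)
  have fV: "{0..int N} \<subseteq> f ` V"
  proof -
    have "set P \<subseteq> f ` V"
    proof
      fix x assume "x \<in> set P"
      then obtain j where "j \<le> m" "x = P ! j" using len by (metis in_set_conv_nth less_Suc_eq_le)
      moreover from this have "p j \<in> C 0" using p(1) by (auto simp: bij_betw_def)
      then have "p j \<in> V" unfolding Vsplit by auto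
      ultimately show "x \<in> f ` V" using fp by (metis image_eqI)
    qed
    moreover have "set (cyc i) \<subseteq> f ` V" if i: "i \<in> {1..s}" for i
    proof
      fix x assume "x \<in> set (cyc i)"
      then obtain j where "j < l i" "x = cyc i ! j" using cyc[OF i] by (auto simp: in_set_conv_nth)
      moreover from this have "c i j \<in> V" using c(1)[OF i] i Vsplit by (fastforce simp: bij_betw_def)
      ultimately show "x \<in> f ` V" using fc[OF i] by (metis image_eqI)
    qed
    ultimately show ?thesis using Vcov by blast
  qed
  have split0: "{0..s} = insert 0 {1..s}" by auto
  have "card V \<le> (\<Sum>i\<in>{0..s}. card (C i))"
    unfolding Vsplit by (rule card_UN_le) simp
  also have "\<dots> = card (C 0) + (\<Sum>i=1..s. card (C i))" unfolding split0 by simp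
  also have "(\<Sum>i=1..s. card (C i)) = (\<Sum>i=1..s. l i)"
    using bij_betw_same_card[OF c(1)] by (intro sum.cong) auto
  also have "card (C 0) = Suc m" using bij_betw_same_card[OF p(1)] by simp
  finally have "card V \<le> Suc N" by (simp add: N_def)
  then have cardV: "card V \<le> card {0..int N}" by simp
  note V = inj_on_image_eq_if_card_le[OF finV fV cardV]

  have E: "E = (\<Union>i\<in>{0..s}. induced_edges E (C i))"
  proof
    show "E \<subseteq> (\<Union>i\<in>{0..s}. induced_edges E (C i))"
    proof
      fix e assume "e \<in> E"
      then obtain W where "W \<in> components V E" "e \<in> induced_edges E W"
        using edge_in_component[OF sg] by blast
      then show "e \<in> (\<Union>i\<in>{0..s}. induced_edges E (C i))" unfolding comp by blast
    qed
  qed (auto simp: induced_edges_def)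
  have card_path: "finite (induced_edges E (C 0)) \<and> card (induced_edges E (C 0)) \<le> m"
  proof -
    have "induced_edges E (C 0) = (\<lambda>j. {p j, p (Suc j)}) ` {..<m}" unfolding p(2) by auto
    then show ?thesis using card_image_le[of "{..<m}" "\<lambda>j. {p j, p (Suc j)}"] by simp
  qed
  have card_cyc: "finite (induced_edges E (C i)) \<and> card (induced_edges E (C i)) \<le> l i" if "i \<in> {1..s}" for i
  proof -
    have "induced_edges E (C i) = (\<lambda>j. {c i j, c i (Suc j mod l i)}) ` {..<l i}" unfolding c(2)[OF that] by auto
    then show ?thesis using card_image_le[of "{..<l i}" "\<lambda>j. {c i j, c i (Suc j mod l i)}"] by simp
  qed
  have "finite (\<Union>i\<in>{0..s}. induced_edges E (C i))"
    unfolding split0 using card_path card_cyc by auto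
  then have finE: "finite E" by (simp add: E[symmetric])
  have "card E \<le> (\<Sum>i\<in>{0..s}. card (induced_edges E (C i)))"
    using card_UN_le[of "{0..s}" "\<lambda>i. induced_edges E (C i)"] by (simp add: E[symmetric])
  also have "\<dots> = card (induced_edges E (C 0)) + (\<Sum>i=1..s. card (induced_edges E (C i)))"
    unfolding split0 by simp
  also have "\<dots> \<le> m + (\<Sum>i=1..s. l i)"
    using card_path card_cyc by (intro add_mono sum_mono) auto
  finally have "card E \<le> N" by (simp add: N_def)
  then have cardE: "card E \<le> card {1..int N}" by simp
  have fE: "{1..int N} \<subseteq> edge_diff f ` E"
  proof -
    have "diffs P \<subseteq> edge_diff f ` E"
    proof
      fix d assume "d \<in> diffs P"
      then obtain j where j: "j < m" "d = \<bar>P ! j - P ! Suc j\<bar>" using len by (auto simp: diffs_def)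
      then have "d = edge_diff f {p j, p (Suc j)}" by (simp add: edge_diff_pair fp)
      moreover have "{p j, p (Suc j)} \<in> induced_edges E (C 0)" using j p(2) by auto
      ultimately show "d \<in> edge_diff f ` E" by (auto simp: induced_edges_def)
    qed
    moreover have "diffs (cyc i @ [hd (cyc i)]) \<subseteq> edge_diff f ` E" if i: "i \<in> {1..s}" for i
    proof
      fix d assume "d \<in> diffs (cyc i @ [hd (cyc i)])"
      then obtain j where j: "j < l i" "d = \<bar>(cyc i @ [hd (cyc i)]) ! j - (cyc i @ [hd (cyc i)]) ! Suc j\<bar>"
        using cyc[OF i] by (auto simp: diffs_def)
      \<comment> \<open>For \<open>Suc j = l i\<close> the appended first vertex matches the index
        \<open>0\<close> produced by \<open>mod\<close>: this is the closing edge.\<close>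
      have "cyc i \<noteq> []" using l3[OF i] cyc[OF i] by auto
      then have "(cyc i @ [hd (cyc i)]) ! Suc j = cyc i ! (Suc j mod l i)"
        using j cyc[OF i] by (cases "Suc j = l i") (auto simp: nth_append hd_conv_nth)
      moreover have "Suc j mod l i < l i" using j by simp
      ultimately have "d = edge_diff f {c i j, c i (Suc j mod l i)}"
        using j cyc[OF i] by (simp add: edge_diff_pair fc[OF i] nth_append)
      moreover have "{c i j, c i (Suc j mod l i)} \<in> induced_edges E (C i)" using j c(2)[OF i] by auto
      ultimately show "d \<in> edge_diff f ` E" by (auto simp: induced_edges_def)
    qed
    ultimately show ?thesis using Ecov by blast
  qed
  note Ed = inj_on_image_eq_if_card_le[OF finE fE cardE]
  have "card E = N" using card_image[OF Ed(1)] Ed(2) by simp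
  then have "graceful_labeling V E f"
    using V Ed by (simp add: graceful_labeling_def bij_betw_def)
  then show ?thesis by blast
qed

section \<open>From the real bounds to integer inequalities\<close>

theorem theorem1p5:
  fixes V :: "'a set" and E :: "'a set set"
    and s m :: nat and l :: "nat \<Rightarrow> nat"
  assumes "\<And>i. i \<in> {1..s} \<Longrightarrow> l i \<ge> 3"
    and "cycles_and_path V E s l m"
    and "real m \<ge> 6 * max 1 (m_zero s l) + 7 * max 3 (m_one s l) + 9"
  shows "\<exists>f. graceful_labeling V E f"
proof -
  let ?M = "image_mset l (mset_set {1..s})" and ?I = "even_idx s l"
  let ?J = "{1..s} - ?I"
  \<comment> \<open>Rounding down is harmless because the quantities to be compared are
    integers.\<close>
  define X where "X = \<lfloor>7 * max 3 (m_one s l)\<rfloor>"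
  define Y where "Y = \<lfloor>6 * max 1 (m_zero s l)\<rfloor>"
  have fin: "finite ?I" "?I \<subseteq> {1..s}" by (auto simp: even_idx_def)
  have even: "filter_mset even ?M = image_mset l (mset_set ?I)"
    by (simp add: filter_mset_image_mset even_idx_def)
  have "?J = {i \<in> {1..s}. odd (l i)}" by (auto simp: even_idx_def)
  then have odd: "filter_mset odd ?M = image_mset l (mset_set ?J)"
    by (simp add: filter_mset_image_mset)
  have "\<exists>r. graceful_from ?M (int m + int (\<Sum>i=1..s. l i)) r"
  proof (rule graceful_from_exists)
    show "3 \<le> j" if "j \<in># ?M" for j using that assms(1) by auto
    have "real_of_int (X + Y + 9) \<le> real m"
      using assms(3) of_int_floor_le[of "7 * max 3 (m_one s l)"] of_int_floor_le[of "6 * max 1 (m_zero s l)"]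
      unfolding X_def Y_def of_int_add of_int_numeral by linarith
    then show "X + Y + 9 \<le> int m + int (\<Sum>i=1..s. l i)" by linarith
    show "21 \<le> X" "6 \<le> Y" by (simp_all add: X_def Y_def le_floor_iff)
    show "7 ^ size (filter_mset odd ?M) * (2 * int j + 1) \<le> X" if "j \<in># filter_mset odd ?M" for j
    proof -
      have "j \<in># image_mset l (mset_set ?J)" using that unfolding odd .
      then have "j \<in> l ` ?J" by simp
      then obtain i where i: "i \<in> ?J" "j = l i" by blast
      define n where "n = card ?J"
      have n: "n > 0" using i by (auto simp: n_def card_gt_0_iff)
      have "card ?J = s - card ?I" "card ?I \<le> s"
        using fin card_mono[of "{1..s}" ?I] by (auto simp: card_Diff_subset)
      \<comment> \<open>An odd cycle exists here, so the exponent is nonnegative and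
        \<open>powi\<close> is an ordinary power. The factor 7 in front of \<open>m_one\<close>
        later raises it to the number of odd cycles.\<close>
      then have "int s - int (card ?I) - 1 = int (n - 1)" using n by (simp add: n_def)
      then have "m_one s l = 7 ^ (n - 1) * real (max0 ((\<lambda>i. 2 * l i + 1) ` ?J))"
        by (simp add: m_one_def)
      moreover have "2 * j + 1 \<le> max0 ((\<lambda>i. 2 * l i + 1) ` ?J)"
        using i by (auto simp: max0_def intro!: Max_ge)
      then have "7 ^ (n - 1) * real (2 * j + 1) \<le> 7 ^ (n - 1) * real (max0 ((\<lambda>i. 2 * l i + 1) ` ?J))"
        by (intro mult_left_mono) auto
      ultimately have "7 ^ (n - 1) * (2 * real j + 1) \<le> max 3 (m_one s l)"
        by (simp add: le_max_iff_disj add.commute)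
      moreover have "(7 :: real) ^ n = 7 * 7 ^ (n - 1)" using n by (cases n) auto
      ultimately have "7 ^ n * (2 * real j + 1) \<le> 7 * max 3 (m_one s l)" by simp
      then show ?thesis
        unfolding odd X_def le_floor_iff by (simp add: n_def)
    qed
    show "12 * int (size (filter_mset even ?M)) * (int j + 3) - 6 \<le> Y" if "j \<in># filter_mset even ?M" for j
    proof -
      have "j \<in># image_mset l (mset_set ?I)" using that unfolding even .
      then have "j \<in> l ` ?I" using fin by simp
      then obtain i where i: "i \<in> ?I" "j = l i" by blast
      have "j + 3 \<le> max0 ((\<lambda>i. l i + 3) ` ?I)"
        using i fin by (auto simp: max0_def intro!: Max_ge)
      then have "real (card ?I) * real (j + 3) \<le> real (card ?I) * real (max0 ((\<lambda>i. l i + 3) ` ?I))"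
        by (intro mult_left_mono) auto
      then have "12 * real (card ?I) * (real j + 3) - 6 \<le> 6 * max 1 (m_zero s l)"
        by (simp add: m_zero_def max_def algebra_simps)
      then show ?thesis
        unfolding even Y_def le_floor_iff by simp
    qed
  qed
  then show ?thesis using graceful_of_graceful_from[OF assms(2)] by blast
qed

end
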